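(* Let $p$ be a prime, let $k\le p$ be a positive integer, for each $i\in\{1,\dots,k\}$ let $a_i\in\mathbb{Z}_{\ge0}\cup\{\infty\}$, and let $X$ be the compact $k$-step $p$-homogeneous nilspace $\prod_{i=1}^k\mathcal{D}_i(\mathbb{Z}_p^{a_i})$ (with $\mathbb{Z}_p^\infty:=\mathbb{Z}_p^{\mathbb{N}}$). Then the translation group $\Theta(X)$ can be identified as a set with the Cartesian product $$\mathbb{Z}_p^{a_1}\times\prod_{i=2}^k\hom\Big(\prod_{j=1}^{i-1}\mathcal{D}_j(\mathbb{Z}_p^{a_j}),\,\mathcal{D}_{i-1}(\mathbb{Z}_p^{a_i})\Big),$$ where an element $(T_1,\dots,T_k)$ of this product corresponds to the translation $\alpha\in\Theta(X)$ given by $$\alpha(x_1,\dots,x_k)=(x_1,\dots,x_k)+\big(T_1,T_2(x_1),T_3(x_1,x_2),\dots,T_k(x_1,\dots,x_{k-1})\big).$$ That is, every such formula defines an element of $\Theta(X)$, and every element of $\Theta(X)$ arises in this way from a unique $(T_1,\dots,T_k)$.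
   Context: Nilspaces. A discrete-cube morphism is a map $\{0,1\}^m\to\{0,1\}^n$ that is the restriction of an affine homomorphism $\mathbb{Z}^m\to\mathbb{Z}^n$. A nilspace is a set $X$ with sets $C^n(X)\subset X^{\{0,1\}^n}$, $n\ge0$ (the $n$-cubes), such that: (composition) $c\circ\phi\in C^m(X)$ for every $c\in C^n(X)$ and every discrete-cube morphism $\phi:\{0,1\}^m\to\{0,1\}^n$; (ergodicity) $C^1(X)=X^{\{0,1\}}$; (completion) every map $c':\{0,1\}^n\setminus\{1^n\}\to X$ whose restriction to each face $\{v:v_i=0\}$ is an $(n-1)$-cube extends to an element of $C^n(X)$. It is $k$-step if such completions are unique for $n=k+1$. A morphism is a map $f:X\to Y$ with $f\circ c\in C^n(Y)$ for all $n$ and $c\in C^n(X)$. Product nilspaces have as $n$-cubes the maps all of whose components are $n$-cubes. For an abelian group $A$ and $\ell\ge1$, $\mathcal{D}_\ell(A)$ is the nilspace on $A$ whose $n$-cubes are the maps $c:\{0,1\}^n\to A$ with $\sum_{v\in\{0,1\}^{\ell+1}}(-1)^{v_1+\cdots+v_{\ell+1}}c(\phi(v))=0$ for every discrete-cube morphism $\phi:\{0,1\}^{\ell+1}\to\{0,1\}^n$. The group $\mathbb{Z}_p^{a}$ has the product topology. A translation of a nilspace $X$ is a bijection $\alpha:X\to X$ such that, for $\alpha$ and $\alpha^{-1}$, applying the map to the values of any cube $c\in C^n(X)$ at the vertices of any face of codimension $1$ (leaving other values unchanged) gives a cube. For the compact nilspace $X$ here, $\Theta(X)$ denotes the group of translations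 that are homeomorphisms, and $\hom(\cdot,\cdot)$ denotes the set of continuous morphisms. ($p$-homogeneous means: for every $n\ge 1$ and every morphism $f:\mathcal{D}_1(\mathbb{Z}^n)\to X$, the restriction $f|_{[0,p-1]^n}$ is a morphism $\mathcal{D}_1(\mathbb{Z}_p^n)\to X$, identifying $[0,p-1]^n$ with $\mathbb{Z}_p^n$; this holds for the $X$ above.) *)

theory Defs
  imports
    "HOL-Analysis.Analysis"
    "HOL-Algebra.Product_Groups"
    "HOL-Algebra.Elementary_Groups"
    "HOL-Algebra.FiniteProduct"
    "HOL-Library.Extended_Nat"
    "HOL-Computational_Algebra.Primes"
begin

subsection \<open>Discrete cubes\<close>

abbreviation Zn :: "nat \<Rightarrow> (nat \<Rightarrow> int) monoid" where
  "Zn n \<equiv> product_group {..<n} (\<lambda>_. integer_group)"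

text \<open>The discrete cube, as a subset of the carrier of \<open>Zn n\<close>. All maps out of a set are
  represented by functions that are extensional on that set.\<close>

definition dcube :: "nat \<Rightarrow> (nat \<Rightarrow> int) set" where
  "dcube n = (\<Pi>\<^sub>E i\<in>{..<n}. {0, 1})"

definition dcube_morphisms :: "nat \<Rightarrow> nat \<Rightarrow> ((nat \<Rightarrow> int) \<Rightarrow> (nat \<Rightarrow> int)) set" where
  "dcube_morphisms m n =
     {\<phi> \<in> dcube m \<rightarrow>\<^sub>E dcube n.
        \<exists>h \<in> hom (Zn m) (Zn n). \<exists>b \<in> carrier (Zn n). \<forall>v \<in> dcube m. \<phi> v = h v \<otimes>\<^bsub>Zn n\<^esub> b}"

subsection \<open>Spaces with cubes\<close>

text \<open>The data of a compact nilspace: a topology, whose underlying set is the set of points,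
  and for each \<open>n\<close> a set of \<open>n\<close>-cubes. Translations and continuous morphisms depend on
  these data only.\<close>

record 'a cubespace =
  top_of :: "'a topology"
  cubes :: "nat \<Rightarrow> ((nat \<Rightarrow> int) \<Rightarrow> 'a) set"

abbreviation points :: "'a cubespace \<Rightarrow> 'a set" where
  "points X \<equiv> topspace (top_of X)"

definition cubespace_morphism :: "'a cubespace \<Rightarrow> 'b cubespace \<Rightarrow> ('a \<Rightarrow> 'b) \<Rightarrow> bool" where
  "cubespace_morphism X Y f \<longleftrightarrow>
     f \<in> points X \<rightarrow>\<^sub>E points Y \<and>
     (\<forall>n. \<forall>c \<in> cubes X n. compose (dcube n) f c \<in> cubes Y n)"

definition cont_hom :: "'a cubespace \<Rightarrow> 'b cubespace \<Rightarrow> ('a \<Rightarrow> 'b) set" where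
  "cont_hom X Y = {f. cubespace_morphism X Y f \<and> continuous_map (top_of X) (top_of Y) f}"

definition product_cubespace :: "'i set \<Rightarrow> ('i \<Rightarrow> 'a cubespace) \<Rightarrow> ('i \<Rightarrow> 'a) cubespace" where
  "product_cubespace I X =
     \<lparr>top_of = product_topology (\<lambda>i. top_of (X i)) I,
      cubes = (\<lambda>n. {c \<in> dcube n \<rightarrow>\<^sub>E (\<Pi>\<^sub>E i\<in>I. points (X i)).
                    \<forall>i\<in>I. (\<lambda>v\<in>dcube n. c v i) \<in> cubes (X i) n})\<rparr>"

text \<open>The nilspace \<open>\<D>\<^sub>l(A)\<close> for an abelian group \<open>A\<close> with topology \<open>T\<close>
  (so \<open>topspace T = carrier A\<close>). As \<open>A\<close> is written multiplicatively, the alternating sum in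
  \<open>A\<close> becomes a product of integer powers.\<close>

definition D_space :: "nat \<Rightarrow> ('a, 'b) monoid_scheme \<Rightarrow> 'a topology \<Rightarrow> 'a cubespace" where
  "D_space l A T =
     \<lparr>top_of = T,
      cubes = (\<lambda>n. {c \<in> dcube n \<rightarrow>\<^sub>E carrier A.
                    \<forall>\<phi> \<in> dcube_morphisms (Suc l) n.
                      finprod A (\<lambda>v. c (\<phi> v) [^]\<^bsub>A\<^esub> ((-1::int) ^ nat (\<Sum>i<Suc l. v i)))
                        (dcube (Suc l)) = \<one>\<^bsub>A\<^esub>})\<rparr>"

subsection \<open>Translations\<close>

definition apply_on_face ::
    "nat \<Rightarrow> nat \<Rightarrow> int \<Rightarrow> ('a \<Rightarrow> 'a) \<Rightarrow> ((nat \<Rightarrow> int) \<Rightarrow> 'a) \<Rightarrow> ((nat \<Rightarrow> int) \<Rightarrow> 'a)" where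
  "apply_on_face n i e \<alpha> c = (\<lambda>v\<in>dcube n. if v i = e then \<alpha> (c v) else c v)"

definition preserves_cubes_on_faces :: "'a cubespace \<Rightarrow> ('a \<Rightarrow> 'a) \<Rightarrow> bool" where
  "preserves_cubes_on_faces X \<alpha> \<longleftrightarrow>
     (\<forall>n. \<forall>c \<in> cubes X n. \<forall>i<n. \<forall>e \<in> {0, 1}. apply_on_face n i e \<alpha> c \<in> cubes X n)"

definition translation :: "'a cubespace \<Rightarrow> ('a \<Rightarrow> 'a) \<Rightarrow> bool" where
  "translation X \<alpha> \<longleftrightarrow>
     \<alpha> \<in> extensional (points X) \<and> bij_betw \<alpha> (points X) (points X) \<and>
     preserves_cubes_on_faces X \<alpha> \<and> preserves_cubes_on_faces X (inv_into (points X) \<alpha>)"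

definition Theta :: "'a cubespace \<Rightarrow> ('a \<Rightarrow> 'a) set" where
  "Theta X = {\<alpha>. translation X \<alpha> \<and> homeomorphic_map (top_of X) (top_of X) \<alpha>}"

subsection \<open>Products of the nilspaces \<open>\<D>\<^sub>i(\<int>\<^sub>p\<^sup>a)\<close>\<close>

text \<open>The index set \<open>{j. enat j < a}\<close> is \<open>{0..<a}\<close> for finite \<open>a\<close>, and all of
  \<open>\<nat>\<close> for \<open>a = \<infinity>\<close>.\<close>

definition Zp_power :: "nat \<Rightarrow> enat \<Rightarrow> (nat \<Rightarrow> int) monoid" where
  "Zp_power p a = product_group {j. enat j < a} (\<lambda>_. integer_mod_group p)"

definition Zp_power_top :: "nat \<Rightarrow> enat \<Rightarrow> (nat \<Rightarrow> int) topology" where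
  "Zp_power_top p a =
     product_topology (\<lambda>_. discrete_topology (carrier (integer_mod_group p))) {j. enat j < a}"

abbreviation D_Zp :: "nat \<Rightarrow> nat \<Rightarrow> enat \<Rightarrow> (nat \<Rightarrow> int) cubespace" where
  "D_Zp l p a \<equiv> D_space l (Zp_power p a) (Zp_power_top p a)"

definition prod_D_Zp :: "nat \<Rightarrow> (nat \<Rightarrow> enat) \<Rightarrow> nat \<Rightarrow> (nat \<Rightarrow> nat \<Rightarrow> int) cubespace" where
  "prod_D_Zp p a k = product_cubespace {1..k} (\<lambda>i. D_Zp i p (a i))"

definition prod_Zp_group :: "nat \<Rightarrow> (nat \<Rightarrow> enat) \<Rightarrow> nat \<Rightarrow> (nat \<Rightarrow> nat \<Rightarrow> int) monoid" where
  "prod_Zp_group p a k = product_group {1..k} (\<lambda>i. Zp_power p (a i))"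

text \<open>A tuple \<open>(T\<^sub>1, \<dots>, T\<^sub>k)\<close> is encoded as a pair of \<open>t = T\<^sub>1\<close>, a point, and the family
  \<open>T\<close> of the maps \<open>T\<^sub>2, \<dots>, T\<^sub>k\<close>; the argument \<open>(x\<^sub>1, \<dots>, x\<^sub>i\<^sub>-\<^sub>1)\<close> of \<open>T\<^sub>i\<close> is the restriction of
  \<open>x\<close> to \<open>{1..i - 1}\<close>.\<close>

definition translation_params ::
    "nat \<Rightarrow> (nat \<Rightarrow> enat) \<Rightarrow> nat
      \<Rightarrow> ((nat \<Rightarrow> int) \<times> (nat \<Rightarrow> (nat \<Rightarrow> nat \<Rightarrow> int) \<Rightarrow> nat \<Rightarrow> int)) set" where
  "translation_params p a k =
     carrier (Zp_power p (a 1)) \<times>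
     (\<Pi>\<^sub>E i\<in>{2..k}. cont_hom (prod_D_Zp p a (i - 1)) (D_Zp (i - 1) p (a i)))"

definition translation_of ::
    "nat \<Rightarrow> (nat \<Rightarrow> enat) \<Rightarrow> nat
      \<Rightarrow> (nat \<Rightarrow> int) \<times> (nat \<Rightarrow> (nat \<Rightarrow> nat \<Rightarrow> int) \<Rightarrow> nat \<Rightarrow> int)
      \<Rightarrow> (nat \<Rightarrow> nat \<Rightarrow> int) \<Rightarrow> (nat \<Rightarrow> nat \<Rightarrow> int)" where
  "translation_of p a k = (\<lambda>(t, T). \<lambda>x \<in> points (prod_D_Zp p a k).
     x \<otimes>\<^bsub>prod_Zp_group p a k\<^esub>
       (\<lambda>i\<in>{1..k}. if i = 1 then t else T i (restrict x {1..i - 1})))"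

end

theory Submission
  imports Defs
begin

text \<open>
  Points of \<open>\<D>\<^sub>l(\<int>\<^sub>p\<^sup>b)\<close> have coordinates in \<open>\<int>\<^sub>p\<close>, and a map from a discrete cube is a cube of \<open>\<D>\<^sub>l(\<int>\<^sub>p\<^sup>b)\<close> if and only if each of its
  coordinates is a function of degree at most \<open>l\<close> on the discrete cube (\<open>degree_le\<close>,
  \<open>cubes_prod_D_Zp\<close>). The theorem is a statement about such degrees.

  Applying \<open>\<alpha>\<close> to a cube \<open>c\<close> on a face \<open>F\<close> only changes \<open>c\<close> by \<open>1\<^sub>F \<cdot> (\<alpha> \<circ> c - c)\<close>. As \<open>1\<^sub>F\<close> has degree one, face
  modifications by \<open>\<alpha>\<close> preserve cubes if and only if the \<open>i\<close>-th component of \<open>\<alpha> \<circ> c - c\<close> has degree at most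
  \<open>i - 1\<close> for every cube \<open>c\<close> (\<open>preserves_cubes_on_faces_iff\<close>). In other words, the \<open>i\<close>-th component of the displacement
  \<open>\<alpha> - id\<close> is a morphism from the product to \<open>\<D>\<^sub>i\<^sub>-\<^sub>1\<close>.

  Such a morphism cannot see the components \<open>x\<^sub>j\<close> with \<open>j \<ge> i\<close>: changing them at the top vertex of a
  constant \<open>i\<close>-dimensional cube gives again a cube, while a function of degree at most \<open>i - 1\<close> on that cube is determined by
  its values at the other vertices (\<open>difference_depends_on_lower_components\<close>). Hence every
  translation is triangular, \<open>\<alpha>(x)\<^sub>i = x\<^sub>i + T\<^sub>i(x\<^sub>1, \<dots>, x\<^sub>i\<^sub>-\<^sub>1)\<close>, and the \<open>T\<^sub>i\<close> are found by
  evaluating \<open>\<alpha>\<close> at points that vanish from component \<open>i\<close> on (\<open>params_of_mem\<close>,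
  \<open>translation_of_params_of\<close>); for \<open>i = 1\<close> one gets a constant.

  Conversely, a triangular map with continuous morphisms \<open>T\<^sub>i\<close> is bijective because it can be
  inverted one component at a time, its inverse is triangular in the same sense
  (\<open>inverse_preserves\<close>), and it is a homeomorphism because the space is compact and Hausdorff
  (\<open>translation_of_mem\<close>).
\<close>

section \<open>Morphisms of discrete cubes\<close>

text \<open>A coordinate of a discrete-cube morphism is affine with values in \<open>{0, 1}\<close>, which leaves only
  constants, coordinates and negated coordinates. This makes compositions and restrictions to
  faces of morphisms computable without any reference to the underlying group homomorphism.\<close>

definition cube_coordinate :: "nat \<Rightarrow> ((nat \<Rightarrow> int) \<Rightarrow> int) \<Rightarrow> bool" where
  "cube_coordinate m g \<longleftrightarrow>
     (\<exists>b. \<forall>v\<in>dcube m. g v = b) \<or>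
     (\<exists>j<m. (\<forall>v\<in>dcube m. g v = v j) \<or> (\<forall>v\<in>dcube m. g v = 1 - v j))"

lemma finite_dcube: "finite (dcube m)"
  by (simp add: dcube_def finite_PiE)

lemma dcube_coord: "v \<in> dcube m \<Longrightarrow> i < m \<Longrightarrow> v i = 0 \<or> v i = 1"
  by (auto simp: dcube_def PiE_iff)

lemma dcube_eq_1_iff: "v \<in> dcube m \<Longrightarrow> i < m \<Longrightarrow> v i = 1 \<longleftrightarrow> v i \<noteq> 0"
  using dcube_coord by force

lemma dcubeI: "(\<And>i. i < m \<Longrightarrow> f i = 0 \<or> f i = 1) \<Longrightarrow> (\<lambda>i\<in>{..<m}. f i) \<in> dcube m"
  by (auto simp: dcube_def)

lemma dcube_eqI: "u \<in> dcube m \<Longrightarrow> v \<in> dcube m \<Longrightarrow> (\<And>i. i < m \<Longrightarrow> u i = v i) \<Longrightarrow> u = v"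
  unfolding dcube_def by (metis PiE_ext lessThan_iff)

lemma carrier_Zn: "carrier (Zn n) = extensional {..<n}"
  by (auto simp: PiE_def)

lemma additive_expansion:
  fixes L :: "(nat \<Rightarrow> int) \<Rightarrow> int"
  assumes add: "\<And>u v. u \<in> extensional {..<m} \<Longrightarrow> v \<in> extensional {..<m} \<Longrightarrow>
                  L (\<lambda>i\<in>{..<m}. u i + v i) = L u + L v"
    and v: "v \<in> dcube m"
  shows "L v = (\<Sum>j<m. v j * L (\<lambda>i\<in>{..<m}. if i = j then 1 else 0))"
proof -
  define trunc where "trunc r = (\<lambda>i\<in>{..<m}. if i < r then v i else 0)" for r :: nat
  define e where "e j = (\<lambda>i\<in>{..<m}. if i = j then 1 else (0::int))" for j
  have L0: "L (trunc 0) = 0"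
    using add[of "trunc 0" "trunc 0"] by (auto simp: trunc_def cong: restrict_cong)
  \<comment> \<open>Coordinates are \<open>0\<close> or \<open>1\<close>, so each truncation is the previous one, possibly plus a basis vector.\<close>
  have expand: "L (trunc r) = (\<Sum>j<r. v j * L (e j))" if "r \<le> m" for r
    using that
  proof (induction r)
    case 0
    show ?case using L0 by simp
  next
    case (Suc r)
    consider "v r = 0" | "v r = 1" using dcube_coord[OF v, of r] Suc.prems by auto
    then show ?case
    proof cases
      case 1
      then have "trunc (Suc r) = trunc r"
        by (auto simp: trunc_def less_Suc_eq)
      then show ?thesis using Suc 1 by simp
    next
      case 2
      have "trunc (Suc r) = (\<lambda>i\<in>{..<m}. trunc r i + e r i)"
        using 2 by (auto simp: trunc_def e_def less_Suc_eq)
      then have "L (trunc (Suc r)) = L (trunc r) + L (e r)"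
        using add[of "trunc r" "e r"] by (simp add: trunc_def e_def)
      then show ?thesis using Suc 2 by simp
    qed
  qed
  have "trunc m = v"
    using v by (auto simp: trunc_def dcube_def PiE_iff extensional_def)
  with expand[of m] show ?thesis unfolding e_def by simp
qed

text \<open>Two nonzero slopes \<open>L e\<^sub>j\<close> and \<open>L e\<^sub>k\<close> are impossible: the values of \<open>L + b\<close> at \<open>0\<close>, \<open>e\<^sub>j\<close>, \<open>e\<^sub>k\<close> and
  \<open>e\<^sub>j + e\<^sub>k\<close> would be \<open>b\<close>, \<open>1 - b\<close>, \<open>1 - b\<close> and \<open>2 - 3 b\<close>, and the last one is not in \<open>{0, 1}\<close>.\<close>

lemma affine_01_coordinate:
  fixes L :: "(nat \<Rightarrow> int) \<Rightarrow> int"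
  assumes add: "\<And>u v. u \<in> extensional {..<m} \<Longrightarrow> v \<in> extensional {..<m} \<Longrightarrow>
                  L (\<lambda>i\<in>{..<m}. u i + v i) = L u + L v"
    and val: "\<And>v. v \<in> dcube m \<Longrightarrow> L v + b \<in> {0, 1}"
  shows "cube_coordinate m (\<lambda>v. L v + b)"
proof -
  define e where "e j = (\<lambda>i\<in>{..<m}. if i = j then 1 else (0::int))" for j
  have e: "e j \<in> dcube m" for j unfolding e_def by (rule dcubeI) auto
  have exp: "L v = (\<Sum>j<m. v j * L (e j))" if "v \<in> dcube m" for v
    unfolding e_def by (rule additive_expansion[OF _ that]) (rule add)
  have z: "(\<lambda>i\<in>{..<m}. 0) \<in> dcube m" by (rule dcubeI) auto
  have b: "b \<in> {0,1}" using val[OF z] exp[OF z] by simp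
  show ?thesis
  proof (cases "\<exists>j<m. L (e j) \<noteq> 0")
    case False
    then show ?thesis using exp by (auto simp: cube_coordinate_def)
  next
    case True
    then obtain j where j: "j < m" "L (e j) \<noteq> 0" by auto
    have others: "L (e k) = 0" if "k < m" "k \<noteq> j" for k
    proof -
      have "(\<lambda>i\<in>{..<m}. e j i + e k i) \<in> dcube m"
        by (rule dcubeI) (use that in \<open>auto simp: e_def\<close>)
      from val[OF this] have "L (e j) + L (e k) + b \<in> {0,1}"
        by (subst (asm) add) (simp_all add: e_def)
      then show ?thesis using val[OF e[of j]] val[OF e[of k]] b j by auto
    qed
    have Lv: "L v = v j * L (e j)" if "v \<in> dcube m" for v
    proof -
      have "L v = v j * L (e j) + (\<Sum>k\<in>{..<m} - {j}. v k * L (e k))"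
        using exp[OF that] j by (simp add: sum.remove[of _ j])
      also have "(\<Sum>k\<in>{..<m} - {j}. v k * L (e k)) = 0"
        by (rule sum.neutral) (use others in auto)
      finally show ?thesis by simp
    qed
    have "L (e j) = 1 \<and> b = 0 \<or> L (e j) = -1 \<and> b = 1"
      using val[OF e[of j]] b j by auto
    then show ?thesis unfolding cube_coordinate_def using Lv j by auto
  qed
qed

lemma dcube_morphisms_iff:
  "\<phi> \<in> dcube_morphisms m n \<longleftrightarrow>
     \<phi> \<in> dcube m \<rightarrow>\<^sub>E dcube n \<and> (\<forall>i<n. cube_coordinate m (\<lambda>v. \<phi> v i))"
proof
  assume "\<phi> \<in> dcube_morphisms m n"
  then obtain h b where h: "h \<in> hom (Zn m) (Zn n)" and b: "b \<in> carrier (Zn n)"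
    and \<phi>: "\<phi> \<in> dcube m \<rightarrow>\<^sub>E dcube n" "\<And>v. v \<in> dcube m \<Longrightarrow> \<phi> v = h v \<otimes>\<^bsub>Zn n\<^esub> b"
    by (auto simp: dcube_morphisms_def)
  have "cube_coordinate m (\<lambda>v. \<phi> v i)" if i: "i < n" for i
  proof -
    have "cube_coordinate m (\<lambda>v. h v i + b i)"
    proof (rule affine_01_coordinate[where L = "\<lambda>v. h v i"])
      fix u v :: "nat \<Rightarrow> int" assume uv: "u \<in> extensional {..<m}" "v \<in> extensional {..<m}"
      then have "h (u \<otimes>\<^bsub>Zn m\<^esub> v) = h u \<otimes>\<^bsub>Zn n\<^esub> h v"
        using h by (simp only: hom_def carrier_Zn mem_Collect_eq)
      from fun_cong[OF this, of i] show "h (\<lambda>i\<in>{..<m}. u i + v i) i = h u i + h v i"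
        using i by (simp add: integer_group_def)
    next
      fix v assume v: "v \<in> dcube m"
      have "\<phi> v \<in> dcube n" using \<phi>(1) v by auto
      then show "h v i + b i \<in> {0,1}"
        using \<phi>(2)[OF v] dcube_coord[of "\<phi> v" n i] i by (auto simp: integer_group_def)
    qed
    then show ?thesis
      using \<phi>(2) i by (simp add: cube_coordinate_def integer_group_def)
  qed
  then show "\<phi> \<in> dcube m \<rightarrow>\<^sub>E dcube n \<and> (\<forall>i<n. cube_coordinate m (\<lambda>v. \<phi> v i))"
    using \<phi> by simp
next
  assume *: "\<phi> \<in> dcube m \<rightarrow>\<^sub>E dcube n \<and> (\<forall>i<n. cube_coordinate m (\<lambda>v. \<phi> v i))"
  \<comment> \<open>One witness \<open>t\<close> for slope, constant and index together, so that a single choice suffices.\<close>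
  define affine where "affine i t \<longleftrightarrow> (case t of (s, b, j) \<Rightarrow>
      (s = 0 \<or> j < m) \<and> (\<forall>v\<in>dcube m. \<phi> v i = s * v j + b))" for i and t :: "int \<times> int \<times> nat"
  have "\<exists>t. affine i t" if i: "i < n" for i
  proof -
    consider b where "\<forall>v\<in>dcube m. \<phi> v i = b" | j where "j < m" "\<forall>v\<in>dcube m. \<phi> v i = v j"
      | j where "j < m" "\<forall>v\<in>dcube m. \<phi> v i = 1 - v j"
      using conjunct2[OF *, rule_format, OF i] unfolding cube_coordinate_def by blast
    then show ?thesis
    proof cases
      case (1 b) then show ?thesis by (intro exI[of _ "(0, b, 0)"]) (auto simp: affine_def)
    next
      case (2 j) then show ?thesis by (intro exI[of _ "(1, 0, j)"]) (auto simp: affine_def)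
    next
      case (3 j) then show ?thesis by (intro exI[of _ "(-1, 1, j)"]) (auto simp: affine_def)
    qed
  qed
  then have "\<forall>i. \<exists>t. i < n \<longrightarrow> affine i t" by blast
  from choice[OF this] obtain t where t: "\<And>i. i < n \<Longrightarrow> affine i (t i)" by blast
  define s b j where "s i = fst (t i)" and "b i = fst (snd (t i))" and "j i = snd (snd (t i))" for i
  have sbj: "s i = 0 \<or> j i < m" "\<And>v. v \<in> dcube m \<Longrightarrow> \<phi> v i = s i * v (j i) + b i"
    if "i < n" for i
    using t[OF that] by (auto simp: affine_def s_def b_def j_def split: prod.splits)
  define h :: "(nat \<Rightarrow> int) \<Rightarrow> (nat \<Rightarrow> int)"
    where "h v = (\<lambda>i\<in>{..<n}. s i * v (j i))" for v
  have "h \<in> hom (Zn m) (Zn n)"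
  proof (rule homI)
    fix u v assume "u \<in> carrier (Zn m)" "v \<in> carrier (Zn m)"
    have "s i * (u \<otimes>\<^bsub>Zn m\<^esub> v) (j i) = s i * u (j i) + s i * v (j i)" if "i < n" for i
      using sbj(1)[OF that] by (auto simp: integer_group_def distrib_left)
    then show "h (u \<otimes>\<^bsub>Zn m\<^esub> v) = h u \<otimes>\<^bsub>Zn n\<^esub> h v"
      unfolding h_def mult_product_group by (intro restrict_ext) (simp add: integer_group_def)
  qed (simp add: h_def)
  moreover have "(\<lambda>i\<in>{..<n}. b i) \<in> carrier (Zn n)" by simp
  moreover have "\<phi> v = h v \<otimes>\<^bsub>Zn n\<^esub> (\<lambda>i\<in>{..<n}. b i)" if v: "v \<in> dcube m" for v
  proof -
    have "\<phi> v \<in> extensional {..<n}"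
      using PiE_mem[OF conjunct1[OF *] v] by (simp add: dcube_def PiE_iff)
    moreover have "\<phi> v i = h v i + b i" if "i < n" for i
      using sbj(2)[OF that v] that by (simp add: h_def)
    ultimately show ?thesis
      by (intro extensionalityI[of "\<phi> v" "{..<n}"]) (simp_all add: integer_group_def)
  qed
  ultimately show "\<phi> \<in> dcube_morphisms m n"
    unfolding dcube_morphisms_def
    by (intro CollectI conjI bexI[of _ h] bexI[of _ "\<lambda>i\<in>{..<n}. b i"] ballI) (use * in simp_all)
qed

lemma cube_coordinate_compose:
  assumes "cube_coordinate n g" "\<phi> \<in> dcube_morphisms m n"
  shows "cube_coordinate m (\<lambda>v. g (\<phi> v))"
proof -
  have mem: "\<phi> v \<in> dcube n" if "v \<in> dcube m" for v
    using assms(2) that by (auto simp: dcube_morphisms_iff)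
  consider b where "\<forall>v\<in>dcube n. g v = b" | j where "j < n" "\<forall>v\<in>dcube n. g v = v j"
    | j where "j < n" "\<forall>v\<in>dcube n. g v = 1 - v j"
    using assms(1) by (auto simp: cube_coordinate_def)
  then show ?thesis
  proof cases
    case 1 then show ?thesis using mem by (auto simp: cube_coordinate_def)
  next
    case (2 j)
    then show ?thesis using mem assms(2) by (auto simp: cube_coordinate_def dcube_morphisms_iff)
  next
    case (3 j)
    then have "cube_coordinate m (\<lambda>v. \<phi> v j)" using assms(2) by (auto simp: dcube_morphisms_iff)
    moreover have "\<forall>v\<in>dcube m. g (\<phi> v) = 1 - \<phi> v j" using 3 mem by auto
    ultimately show ?thesis by (auto simp: cube_coordinate_def)
  qed
qed

lemma dcube_morphisms_mem: "\<phi> \<in> dcube_morphisms m n \<Longrightarrow> v \<in> dcube m \<Longrightarrow> \<phi> v \<in> dcube n"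
  by (auto simp: dcube_morphisms_iff)

lemma dcube_morphisms_compose:
  assumes "\<psi> \<in> dcube_morphisms l m" "\<phi> \<in> dcube_morphisms m n"
  shows "compose (dcube l) \<phi> \<psi> \<in> dcube_morphisms l n"
  unfolding dcube_morphisms_iff
proof (intro conjI allI impI)
  show "compose (dcube l) \<phi> \<psi> \<in> dcube l \<rightarrow>\<^sub>E dcube n"
    using dcube_morphisms_mem[OF assms(1)] dcube_morphisms_mem[OF assms(2)] by (simp add: compose_def)
  fix i assume "i < n"
  then have "cube_coordinate m (\<lambda>w. \<phi> w i)"
    using assms(2) by (auto simp: dcube_morphisms_iff)
  from cube_coordinate_compose[OF this assms(1)] show "cube_coordinate l (\<lambda>v. compose (dcube l) \<phi> \<psi> v i)"
    by (simp add: cube_coordinate_def compose_def)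
qed

section \<open>Alternating sums and faces\<close>

definition signed_sum :: "nat \<Rightarrow> ((nat \<Rightarrow> int) \<Rightarrow> int) \<Rightarrow> int" where
  "signed_sum m F = (\<Sum>v\<in>dcube m. (-1) ^ nat (\<Sum>i<m. v i) * F v)"

text \<open>The embedding of the face \<open>{v. v j = e}\<close>. The coordinate that \<open>e\<close> displaces is moved to the new last
  position instead of shifting all later coordinates; this changes the embedding only by a
  permutation of coordinates and keeps the parity of \<open>v\<close> easy to track.\<close>

definition face_embedding :: "nat \<Rightarrow> nat \<Rightarrow> int \<Rightarrow> (nat \<Rightarrow> int) \<Rightarrow> nat \<Rightarrow> int" where
  "face_embedding m j e = (\<lambda>v\<in>dcube m. \<lambda>i\<in>{..<Suc m}. if i = j then e else if i = m then v j else v i)"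

lemma face_embedding_morphism:
  assumes "j \<le> m" "e \<in> {0, 1}"
  shows "face_embedding m j e \<in> dcube_morphisms m (Suc m)"
  unfolding dcube_morphisms_iff
proof (intro conjI allI impI)
  show "face_embedding m j e \<in> dcube m \<rightarrow>\<^sub>E dcube (Suc m)"
    using assms unfolding face_embedding_def
    by (auto intro!: dcubeI simp: dcube_eq_1_iff)
  fix i assume i: "i < Suc m"
  then consider "i = j" | "i = m" "j < m" "i \<noteq> j" | "i < m" "i \<noteq> j"
    using assms by linarith
  then show "cube_coordinate m (\<lambda>v. face_embedding m j e v i)"
    using i by cases (auto simp: cube_coordinate_def face_embedding_def)
qed

lemma face_embedding_coord:
  "j \<le> m \<Longrightarrow> v \<in> dcube m \<Longrightarrow> face_embedding m j e v j = e"
  by (simp add: face_embedding_def)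

lemma sum_face_embedding:
  assumes "j \<le> m" "v \<in> dcube m"
  shows "(\<Sum>i<Suc m. face_embedding m j e v i) = (\<Sum>i<m. v i) + e"
proof (cases "j = m")
  case True
  then show ?thesis using assms by (simp add: face_embedding_def)
next
  case False
  then have j: "j < m" using assms by simp
  have "(\<Sum>i<m. face_embedding m j e v i) = e + (\<Sum>i\<in>{..<m}-{j}. v i)"
    using j assms by (simp add: sum.remove[of _ j] face_embedding_def)
  moreover have "(\<Sum>i<m. v i) = v j + (\<Sum>i\<in>{..<m}-{j}. v i)"
    using j by (simp add: sum.remove[of _ j])
  ultimately show ?thesis using j assms by (simp add: face_embedding_def)
qed

lemma bij_face_embedding:
  assumes "j \<le> m" "e \<in> {0, 1}"
  shows "bij_betw (face_embedding m j e) (dcube m) {v \<in> dcube (Suc m). v j = e}"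
  unfolding bij_betw_def
proof
  show "inj_on (face_embedding m j e) (dcube m)"
  proof (rule inj_onI)
    fix u v assume uv: "u \<in> dcube m" "v \<in> dcube m" "face_embedding m j e u = face_embedding m j e v"
    show "u = v"
    proof (rule dcube_eqI[OF uv(1,2)])
      fix i assume "i < m"
      then show "u i = v i"
        using fun_cong[OF uv(3), of "if i = j then m else i"] uv(1,2) assms(1)
        by (auto simp: face_embedding_def split: if_splits)
    qed
  qed
  show "face_embedding m j e ` dcube m = {v \<in> dcube (Suc m). v j = e}"
  proof (intro equalityI subsetI)
    fix w assume "w \<in> face_embedding m j e ` dcube m"
    then show "w \<in> {v \<in> dcube (Suc m). v j = e}"
      using dcube_morphisms_mem[OF face_embedding_morphism[OF assms]] face_embedding_coord[OF assms(1)]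
      by auto
  next
    fix w assume w: "w \<in> {v \<in> dcube (Suc m). v j = e}"
    define v where "v = (\<lambda>i\<in>{..<m}. if i = j then w m else w i)"
    have v: "v \<in> dcube m"
      unfolding v_def by (rule dcubeI) (use w in \<open>auto simp: dcube_eq_1_iff\<close>)
    have "face_embedding m j e v = w"
      by (rule dcube_eqI[OF dcube_morphisms_mem[OF face_embedding_morphism[OF assms] v]])
        (use w v assms(1) in \<open>auto simp: face_embedding_def v_def less_Suc_eq\<close>)
    then show "w \<in> face_embedding m j e ` dcube m" using v by blast
  qed
qed

text \<open>The vertices with \<open>v j = 1\<close> have one more nonzero coordinate, hence the opposite sign: an
  alternating sum over a cube is the difference of the alternating sums over two opposite faces.
  All degree estimates come from this identity.\<close>

lemma signed_sum_split:
  assumes "j \<le> m"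
  shows "signed_sum (Suc m) F =
    signed_sum m (\<lambda>v. F (face_embedding m j 0 v)) - signed_sum m (\<lambda>v. F (face_embedding m j 1 v))"
proof -
  let ?G = "\<lambda>v. (-1) ^ nat (\<Sum>i<Suc m. v i) * F v"
  have part: "(\<Sum>v | v \<in> dcube (Suc m) \<and> v j = e. ?G v) =
      (-1) ^ nat e * signed_sum m (\<lambda>v. F (face_embedding m j e v))" if e: "e \<in> {0,1}" for e
  proof -
    have "(\<Sum>v | v \<in> dcube (Suc m) \<and> v j = e. ?G v) = (\<Sum>v\<in>dcube m. ?G (face_embedding m j e v))"
      using sum.reindex_bij_betw[OF bij_face_embedding[OF assms e], of ?G] by simp
    also have "\<dots> = (\<Sum>v\<in>dcube m. (-1) ^ nat e * ((-1) ^ nat (\<Sum>i<m. v i) * F (face_embedding m j e v)))"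
    proof (rule sum.cong[OF refl])
      fix v assume v: "v \<in> dcube m"
      then have "0 \<le> (\<Sum>i<m. v i)" by (intro sum_nonneg) (use dcube_coord in force)
      then show "?G (face_embedding m j e v) =
          (-1) ^ nat e * ((-1) ^ nat (\<Sum>i<m. v i) * F (face_embedding m j e v))"
        unfolding sum_face_embedding[OF assms v] using e by (auto simp: nat_add_distrib power_add)
    qed
    finally show ?thesis by (simp add: signed_sum_def sum_distrib_left)
  qed
  have "dcube (Suc m) = {v \<in> dcube (Suc m). v j = 0} \<union> {v \<in> dcube (Suc m). v j = 1}"
    using assms by (auto simp: dcube_eq_1_iff)
  then have "sum ?G (dcube (Suc m)) =
      sum ?G ({v \<in> dcube (Suc m). v j = 0} \<union> {v \<in> dcube (Suc m). v j = 1})"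
    by (rule arg_cong)
  also have "\<dots> = (\<Sum>v | v \<in> dcube (Suc m) \<and> v j = 0. ?G v) + (\<Sum>v | v \<in> dcube (Suc m) \<and> v j = 1. ?G v)"
    by (rule sum.union_disjoint) (auto simp: finite_dcube)
  finally have "signed_sum (Suc m) F =
      (\<Sum>v | v \<in> dcube (Suc m) \<and> v j = 0. ?G v) + (\<Sum>v | v \<in> dcube (Suc m) \<and> v j = 1. ?G v)"
    by (simp only: signed_sum_def)
  then show ?thesis by (simp add: part del: sum.lessThan_Suc)
qed

section \<open>Degrees of functions on discrete cubes\<close>

text \<open>The scalar, integer-valued form of the equations that cut out the cubes of \<open>\<D>\<^sub>l(\<int>\<^sub>p)\<close>. Since vertices
  have \<open>v\<^sub>i\<^sup>2 = v\<^sub>i\<close>, it says that the multilinear polynomial representing \<open>f\<close> modulo \<open>p\<close> has degree at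
  most \<open>l\<close>; the rules below are the familiar ones for degrees.\<close>

definition degree_le :: "nat \<Rightarrow> nat \<Rightarrow> nat \<Rightarrow> ((nat \<Rightarrow> int) \<Rightarrow> int) \<Rightarrow> bool" where
  "degree_le p l n f \<longleftrightarrow>
     (\<forall>\<phi>\<in>dcube_morphisms (Suc l) n. int p dvd signed_sum (Suc l) (\<lambda>v. f (\<phi> v)))"

lemma signed_sum_cong: "(\<And>v. v \<in> dcube m \<Longrightarrow> F v = G v) \<Longrightarrow> signed_sum m F = signed_sum m G"
  unfolding signed_sum_def by (rule sum.cong) auto

lemma signed_sum_add: "signed_sum m (\<lambda>v. F v + G v) = signed_sum m F + signed_sum m G"
  by (simp add: signed_sum_def distrib_left sum.distrib)

lemma signed_sum_diff: "signed_sum m (\<lambda>v. F v - G v) = signed_sum m F - signed_sum m G"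
  by (simp add: signed_sum_def right_diff_distrib sum_subtractf)

lemma signed_sum_0: "signed_sum m (\<lambda>v. 0) = 0"
  by (simp add: signed_sum_def)

lemma signed_sum_dvd: "(\<And>v. v \<in> dcube m \<Longrightarrow> d dvd F v) \<Longrightarrow> d dvd signed_sum m F"
  unfolding signed_sum_def by (rule dvd_sum) auto

lemma degree_leD: "degree_le p l n f \<Longrightarrow> \<phi> \<in> dcube_morphisms (Suc l) n \<Longrightarrow>
    int p dvd signed_sum (Suc l) (\<lambda>v. f (\<phi> v))"
  by (simp add: degree_le_def)

lemma degree_le_add:
  "degree_le p l n f \<Longrightarrow> degree_le p l n g \<Longrightarrow> degree_le p l n (\<lambda>v. f v + g v)"
  by (simp add: degree_le_def signed_sum_add)

lemma degree_le_diff: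
  "degree_le p l n f \<Longrightarrow> degree_le p l n g \<Longrightarrow> degree_le p l n (\<lambda>v. f v - g v)"
  by (simp add: degree_le_def signed_sum_diff)

lemma degree_le_0_mod:
  assumes "\<And>v. v \<in> dcube n \<Longrightarrow> int p dvd f v"
  shows "degree_le p l n f"
  unfolding degree_le_def
  by (intro ballI signed_sum_dvd) (rule assms, rule dcube_morphisms_mem)

lemma degree_le_cong_mod:
  assumes "degree_le p l n f" and "\<And>v. v \<in> dcube n \<Longrightarrow> int p dvd g v - f v"
  shows "degree_le p l n g"
proof -
  have "degree_le p l n (\<lambda>v. f v + (g v - f v))"
    by (intro degree_le_add assms(1) degree_le_0_mod assms(2))
  then show ?thesis by simp
qed

lemma degree_le_const: "degree_le p l n (\<lambda>_. d)"
  unfolding degree_le_def by (simp add: signed_sum_split[of 0])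

lemma degree_le_compose:
  assumes "degree_le p l n f" "\<psi> \<in> dcube_morphisms m n"
  shows "degree_le p l m (\<lambda>v. f (\<psi> v))"
  unfolding degree_le_def
proof
  fix \<phi> assume \<phi>: "\<phi> \<in> dcube_morphisms (Suc l) m"
  have "signed_sum (Suc l) (\<lambda>v. f (\<psi> (\<phi> v))) =
      signed_sum (Suc l) (\<lambda>v. f (compose (dcube (Suc l)) \<psi> \<phi> v))"
    by (rule signed_sum_cong) (simp add: compose_def)
  then show "int p dvd signed_sum (Suc l) (\<lambda>v. f (\<psi> (\<phi> v)))"
    using degree_leD[OF assms(1) dcube_morphisms_compose[OF \<phi> assms(2)]] by simp
qed

lemma degree_le_face_embedding:
  assumes "degree_le p l n f" "\<phi> \<in> dcube_morphisms (Suc (Suc l)) n" "j \<le> Suc l" "e \<in> {0, 1}"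
  shows "int p dvd signed_sum (Suc l) (\<lambda>v. f (\<phi> (face_embedding (Suc l) j e v)))"
proof -
  have "signed_sum (Suc l) (\<lambda>v. f (\<phi> (face_embedding (Suc l) j e v))) =
    signed_sum (Suc l) (\<lambda>v. f (compose (dcube (Suc l)) \<phi> (face_embedding (Suc l) j e) v))"
    by (rule signed_sum_cong) (simp add: compose_def)
  then show ?thesis
    using degree_leD[OF assms(1) dcube_morphisms_compose[OF face_embedding_morphism[OF assms(3,4)] assms(2)]]
    by simp
qed

lemma degree_le_Suc:
  assumes "degree_le p l n f"
  shows "degree_le p (Suc l) n f"
  unfolding degree_le_def
proof
  fix \<phi> assume "\<phi> \<in> dcube_morphisms (Suc (Suc l)) n"
  then show "int p dvd signed_sum (Suc (Suc l)) (\<lambda>v. f (\<phi> v))"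
    using degree_le_face_embedding[OF assms, of \<phi> 0]
    by (simp add: signed_sum_split[of 0])
qed

lemma degree_le_mono: "degree_le p l n f \<Longrightarrow> l \<le> m \<Longrightarrow> degree_le p m n f"
  by (induction m) (auto simp: le_Suc_eq degree_le_Suc)

text \<open>The indicator of a codimension-one face has degree at most one, so multiplying by it raises the
  degree by at most one. In terms of alternating sums: a morphism \<open>\<phi>\<close> can be split along a
  coordinate \<open>j\<close> so that each half lies entirely inside or entirely outside the face, and on each half
  the alternating sum is either one that vanishes for \<open>f\<close> or identically zero.\<close>

lemma degree_le_face_indicator:
  assumes f: "degree_le p l n f" and i: "i < n"
  shows "degree_le p (Suc l) n (\<lambda>v. if v i = e then f v else 0)"
  unfolding degree_le_def
proof
  fix \<phi> assume \<phi>: "\<phi> \<in> dcube_morphisms (Suc (Suc l)) n"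
  let ?E = "face_embedding (Suc l)"
  let ?g = "\<lambda>v. if v i = e then f v else 0"
  \<comment> \<open>Split along the input coordinate on which the \<open>i\<close>-th output depends; if there is none, any will do.\<close>
  have "\<exists>j\<le>Suc l. \<forall>e'. e' \<in> {0,1} \<longrightarrow> (\<exists>c. \<forall>v\<in>dcube (Suc l). \<phi> (?E j e' v) i = c)"
  proof -
    have mem: "?E j e' v \<in> dcube (Suc (Suc l))" if "j \<le> Suc l" "e' \<in> {0,1}" "v \<in> dcube (Suc l)" for j e' v
      using dcube_morphisms_mem[OF face_embedding_morphism] that by blast
    have "cube_coordinate (Suc (Suc l)) (\<lambda>v. \<phi> v i)"
      using \<phi> i by (simp add: dcube_morphisms_iff)
    then consider b where "\<forall>v\<in>dcube (Suc (Suc l)). \<phi> v i = b"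
      | j where "j < Suc (Suc l)" "\<forall>v\<in>dcube (Suc (Suc l)). \<phi> v i = v j"
      | j where "j < Suc (Suc l)" "\<forall>v\<in>dcube (Suc (Suc l)). \<phi> v i = 1 - v j"
      unfolding cube_coordinate_def by blast
    then show ?thesis
    proof cases
      case (1 b)
      then show ?thesis using mem[of 0] by (intro exI[of _ 0]) auto
    next
      case (2 j)
      then have "\<phi> (?E j e' v) i = e'" if "e' \<in> {0,1}" "v \<in> dcube (Suc l)" for e' v
        using mem[of j e' v] that face_embedding_coord[of j "Suc l" v e'] by simp
      then show ?thesis using 2(1) by (intro exI[of _ j]) auto
    next
      case (3 j)
      then have "\<phi> (?E j e' v) i = 1 - e'" if "e' \<in> {0,1}" "v \<in> dcube (Suc l)" for e' v
        using mem[of j e' v] that face_embedding_coord[of j "Suc l" v e'] by simp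
      then show ?thesis using 3(1) by (intro exI[of _ j]) auto
    qed
  qed
  then obtain j where j: "j \<le> Suc l"
    and const: "\<And>e'. e' \<in> {0,1} \<Longrightarrow> \<exists>c. \<forall>v\<in>dcube (Suc l). \<phi> (?E j e' v) i = c"
    by blast
  have "int p dvd signed_sum (Suc l) (\<lambda>v. ?g (\<phi> (?E j e' v)))" if e': "e' \<in> {0,1}" for e'
  proof -
    obtain c where c: "\<And>v. v \<in> dcube (Suc l) \<Longrightarrow> \<phi> (?E j e' v) i = c"
      using const[OF e'] by blast
    have "signed_sum (Suc l) (\<lambda>v. ?g (\<phi> (?E j e' v))) =
        (if c = e then signed_sum (Suc l) (\<lambda>v. f (\<phi> (?E j e' v))) else 0)"
      using c by (auto simp: signed_sum_0 cong: signed_sum_cong)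
    then show ?thesis using degree_le_face_embedding[OF f \<phi> j e'] by simp
  qed
  then show "int p dvd signed_sum (Suc (Suc l)) (\<lambda>v. ?g (\<phi> v))"
    unfolding signed_sum_split[OF j] by (intro dvd_diff) auto
qed

lemma restrict_dcube: "v \<in> dcube (Suc n) \<Longrightarrow> restrict v {..<n} \<in> dcube n"
  by (intro dcubeI) (auto simp: dcube_eq_1_iff)

lemma forget_last_morphism: "(\<lambda>v\<in>dcube (Suc n). restrict v {..<n}) \<in> dcube_morphisms (Suc n) n"
  unfolding dcube_morphisms_iff
proof (intro conjI allI impI)
  fix i assume "i < n"
  then show "cube_coordinate (Suc n) (\<lambda>v. (\<lambda>v\<in>dcube (Suc n). restrict v {..<n}) v i)"
    unfolding cube_coordinate_def by (intro disjI2 exI[of _ i]) simp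
qed (simp add: restrict_dcube)

text \<open>A converse of \<open>degree_le_face_indicator\<close> for a new coordinate \<open>w\<close>: if \<open>w f(v)\<close> has degree at
  most \<open>l + 1\<close> in \<open>(v, w)\<close>, then \<open>f\<close> has degree at most \<open>l\<close>. Extending a morphism \<open>\<phi>\<close> by the identity
  on \<open>w\<close> turns the alternating sum of \<open>w f\<close> into minus that of \<open>f\<close>.\<close>

lemma degree_le_of_last_coordinate_multiple:
  assumes "degree_le p (Suc l) (Suc n) (\<lambda>v. if v n = 1 then f (restrict v {..<n}) else 0)"
  shows "degree_le p l n f"
  unfolding degree_le_def
proof
  fix \<phi> assume \<phi>: "\<phi> \<in> dcube_morphisms (Suc l) n"
  let ?L = "Suc l"
  define \<Phi> where "\<Phi> = (\<lambda>v\<in>dcube (Suc ?L). \<lambda>i\<in>{..<Suc n}.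
    if i = n then v ?L else \<phi> (restrict v {..<?L}) i)"
  have \<phi>m: "\<phi> (restrict v {..<?L}) \<in> dcube n" if "v \<in> dcube (Suc ?L)" for v
    by (rule dcube_morphisms_mem[OF \<phi> restrict_dcube[OF that]])
  have "\<Phi> \<in> dcube_morphisms (Suc ?L) (Suc n)"
    unfolding dcube_morphisms_iff
  proof (intro conjI allI impI)
    show "\<Phi> \<in> dcube (Suc ?L) \<rightarrow>\<^sub>E dcube (Suc n)"
      unfolding \<Phi>_def
    proof (intro restrict_PiE_iff[THEN iffD2] ballI dcubeI)
      fix v i assume "v \<in> dcube (Suc ?L)" "i < Suc n"
      then show "(if i = n then v ?L else \<phi> (restrict v {..<?L}) i) = 0 \<or>
          (if i = n then v ?L else \<phi> (restrict v {..<?L}) i) = 1"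
        using dcube_coord[of v "Suc ?L" ?L] dcube_coord[OF \<phi>m, of v i] by (auto simp: less_Suc_eq)
    qed
    fix i assume i: "i < Suc n"
    show "cube_coordinate (Suc ?L) (\<lambda>v. \<Phi> v i)"
    proof (cases "i = n")
      case True
      then show ?thesis by (auto simp: cube_coordinate_def \<Phi>_def)
    next
      case False
      then have "cube_coordinate ?L (\<lambda>v. \<phi> v i)" using \<phi> i by (simp add: dcube_morphisms_iff)
      from cube_coordinate_compose[OF this forget_last_morphism]
      show ?thesis using False i by (simp add: cube_coordinate_def \<Phi>_def)
    qed
  qed
  from degree_leD[OF assms this]
  have dvd: "int p dvd signed_sum (Suc ?L)
      (\<lambda>v. if \<Phi> v n = 1 then f (restrict (\<Phi> v) {..<n}) else 0)" .
  have mem: "face_embedding ?L ?L e v \<in> dcube (Suc ?L)" if "v \<in> dcube ?L" "e \<in> {0,1}" for v e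
    using dcube_morphisms_mem[OF face_embedding_morphism] that by blast
  have last: "\<Phi> (face_embedding ?L ?L e v) n = e" if "v \<in> dcube ?L" "e \<in> {0,1}" for v e
    using mem[OF that] that by (simp add: \<Phi>_def face_embedding_coord)
  have init: "restrict (\<Phi> (face_embedding ?L ?L e v)) {..<n} = \<phi> v"
    if v: "v \<in> dcube ?L" and e: "e \<in> {0,1}" for v e
  proof -
    have "restrict (face_embedding ?L ?L e v) {..<?L} = v"
      by (rule dcube_eqI[OF restrict_dcube[OF mem[OF v e]] v]) (simp add: face_embedding_def v)
    then have "\<Phi> (face_embedding ?L ?L e v) i = \<phi> v i" if "i < n" for i
      using mem[OF v e] that by (simp add: \<Phi>_def)
    moreover have "\<phi> v \<in> extensional {..<n}"
      using dcube_morphisms_mem[OF \<phi> v] by (simp add: dcube_def PiE_iff)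
    ultimately show ?thesis
      by (intro extensionalityI[of _ "{..<n}"]) simp_all
  qed
  have "signed_sum (Suc ?L) (\<lambda>v. if \<Phi> v n = 1 then f (restrict (\<Phi> v) {..<n}) else 0) =
      signed_sum ?L (\<lambda>v. 0) - signed_sum ?L (\<lambda>v. f (\<phi> v))"
    unfolding signed_sum_split[OF order_refl[of ?L]]
    by (intro arg_cong2[where f = "(-)"] signed_sum_cong) (simp_all add: last init)
  then show "int p dvd signed_sum ?L (\<lambda>v. f (\<phi> v))"
    using dvd by (simp add: signed_sum_0)
qed

text \<open>A function of \<open>r\<close> coordinates has degree at most \<open>r\<close>: it is the sum of its restrictions to
  \<open>v\<^sub>r = 0\<close> and \<open>v\<^sub>r = 1\<close>, each of them a function of one coordinate less times a face indicator.\<close>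

lemma degree_le_of_few_coordinates:
  assumes "r \<le> n"
    and "\<And>u v. u \<in> dcube n \<Longrightarrow> v \<in> dcube n \<Longrightarrow> (\<And>i. i < r \<Longrightarrow> u i = v i) \<Longrightarrow> f u = f v"
  shows "degree_le p r n f"
  using assms
proof (induction r arbitrary: f)
  case 0
  have "(\<lambda>i\<in>{..<n}. 0) \<in> dcube n" by (rule dcubeI) simp
  then have "f v = f (\<lambda>i\<in>{..<n}. 0)" if "v \<in> dcube n" for v
    using 0(2) that by blast
  then show ?case
    by (intro degree_le_cong_mod[OF degree_le_const[of p 0 n "f (\<lambda>i\<in>{..<n}. 0)"]]) simp
next
  case (Suc r)
  have upd: "v(r := e) \<in> dcube n" if "v \<in> dcube n" "e \<in> {0,1}" for v e
    using that Suc.prems(1) by (auto simp: dcube_def PiE_iff extensional_def)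
  have "degree_le p r n (\<lambda>v. f (v(r := e)))" if e: "e \<in> {0,1}" for e
  proof (rule Suc.IH)
    show "r \<le> n" using Suc.prems(1) by simp
    fix u v assume uv: "u \<in> dcube n" "v \<in> dcube n" "\<And>i. i < r \<Longrightarrow> u i = v i"
    show "f (u(r := e)) = f (v(r := e))"
      by (rule Suc.prems(2)[OF upd[OF uv(1) e] upd[OF uv(2) e]])
        (use uv(3) in \<open>auto simp: less_Suc_eq\<close>)
  qed
  from degree_le_face_indicator[OF this[of 0], of r 0] degree_le_face_indicator[OF this[of 1], of r 1]
  have "degree_le p (Suc r) n (\<lambda>v. (if v r = 0 then f (v(r := 0)) else 0) +
      (if v r = 1 then f (v(r := 1)) else 0))"
    using Suc.prems(1) by (intro degree_le_add) simp_all
  then show ?case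
  proof (rule degree_le_cong_mod)
    fix v assume v: "v \<in> dcube n"
    have "v r = 0 \<or> v r = 1" using dcube_coord[OF v] Suc.prems(1) by simp
    then show "int p dvd f v - ((if v r = 0 then f (v(r := 0)) else 0) +
        (if v r = 1 then f (v(r := 1)) else 0))"
      using fun_upd_triv[of v r] by (elim disjE) (simp_all only:, simp_all)
  qed
qed

lemma degree_le_dimension:
  assumes "n \<le> l"
  shows "degree_le p l n f"
proof -
  have "degree_le p n n f"
  proof (rule degree_le_of_few_coordinates[OF order_refl])
    fix u v assume "u \<in> dcube n" "v \<in> dcube n" "\<And>i. i < n \<Longrightarrow> u i = v i"
    then show "f u = f v" using dcube_eqI by blast
  qed
  then show ?thesis using assms by (rule degree_le_mono)
qed

lemma identity_morphism: "(\<lambda>v\<in>dcube n. v) \<in> dcube_morphisms n n"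
  unfolding dcube_morphisms_iff by (auto simp: cube_coordinate_def)

text \<open>The function supported at the top vertex of an \<open>(l + 1)\<close>-cube is a multiple of the monomial of degree \<open>l + 1\<close>.
  This is the uniqueness of completion that makes \<open>\<D>\<^sub>l\<close> an \<open>l\<close>-step nilspace.\<close>

lemma degree_le_corner:
  assumes "degree_le p l (Suc l) (\<lambda>v. if v = (\<lambda>i\<in>{..<Suc l}. 1) then d else 0)"
  shows "int p dvd d"
proof -
  let ?one = "\<lambda>i\<in>{..<Suc l}. 1::int"
  have one: "?one \<in> dcube (Suc l)" by (rule dcubeI) simp
  have "signed_sum (Suc l) (\<lambda>v. if (\<lambda>v\<in>dcube (Suc l). v) v = ?one then d else 0) =
      (\<Sum>v\<in>dcube (Suc l). if v = ?one then (-1) ^ nat (\<Sum>i<Suc l. v i) * d else 0)"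
    unfolding signed_sum_def by (rule sum.cong) (simp_all del: sum.lessThan_Suc)
  also have "\<dots> = (-1) ^ nat (\<Sum>i<Suc l. ?one i) * d"
    using one by (simp only: sum.delta' sum.delta finite_dcube if_True)
  finally have "int p dvd (-1) ^ nat (\<Sum>i<Suc l. ?one i) * d"
    using degree_leD[OF assms identity_morphism] by (simp only:)
  then show ?thesis
    by (simp only: minus_one_power_iff dvd_minus_iff mult_minus1 mult_1 split: if_splits)
qed

section \<open>Points and cubes in coordinates\<close>

abbreviation Zp_points :: "nat \<Rightarrow> enat \<Rightarrow> (nat \<Rightarrow> int) set" where
  "Zp_points p b \<equiv> \<Pi>\<^sub>E j\<in>{j. enat j < b}. {0..<int p}"

lemma carrier_Zp_power: "0 < p \<Longrightarrow> carrier (Zp_power p b) = Zp_points p b"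
  by (simp add: Zp_power_def carrier_integer_mod_group)

lemma mult_Zp_power: "x \<otimes>\<^bsub>Zp_power p b\<^esub> y = (\<lambda>j\<in>{j. enat j < b}. (x j + y j) mod int p)"
  by (simp add: Zp_power_def)

lemma comm_group_Zp_power: "comm_group (Zp_power p b)"
proof (rule group.group_comm_groupI)
  show "Group.group (Zp_power p b)" unfolding Zp_power_def by (rule product_group) simp
  show "x \<otimes>\<^bsub>Zp_power p b\<^esub> y = y \<otimes>\<^bsub>Zp_power p b\<^esub> x" for x y
    by (simp add: mult_Zp_power add.commute)
qed

lemma finprod_Zp_power:
  assumes "finite S" "f \<in> S \<rightarrow> carrier (Zp_power p b)" "enat j < b"
  shows "finprod (Zp_power p b) f S j = (\<Sum>v\<in>S. f v j) mod int p"
  using assms(1,2)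
proof (induction S rule: finite_induct)
  case empty
  interpret comm_group "Zp_power p b" by (rule comm_group_Zp_power)
  have "\<one>\<^bsub>Zp_power p b\<^esub> j = 0" using assms(3) by (simp add: Zp_power_def)
  then show ?case by simp
next
  case (insert v S)
  interpret comm_group "Zp_power p b" by (rule comm_group_Zp_power)
  have "finprod (Zp_power p b) f (insert v S) = f v \<otimes>\<^bsub>Zp_power p b\<^esub> finprod (Zp_power p b) f S"
    using insert by (intro finprod_insert) auto
  then show ?case
    using insert assms(3) by (simp add: mult_Zp_power mod_add_right_eq Pi_iff)
qed

text \<open>The exponents in the defining equations of the cubes are only ever \<open>1\<close> and \<open>-1\<close>.\<close>

lemma sign_power_Zp_power:
  assumes "0 < p" "x \<in> carrier (Zp_power p b)" "enat j < b"
  shows "(x [^]\<^bsub>Zp_power p b\<^esub> ((-1::int) ^ m)) j = ((-1) ^ m * x j) mod int p"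
proof -
  interpret comm_group "Zp_power p b" by (rule comm_group_Zp_power)
  have x: "x j \<in> {0..<int p}" using assms carrier_Zp_power by (auto simp: PiE_iff)
  have "inv\<^bsub>Zp_power p b\<^esub> x = (\<lambda>j\<in>{j. enat j < b}. inv\<^bsub>integer_mod_group p\<^esub> (x j))"
    unfolding Zp_power_def by (rule inv_product_group) (use assms(2) in \<open>auto simp: Zp_power_def\<close>)
  then have "(inv\<^bsub>Zp_power p b\<^esub> x) j = (- x j) mod int p"
    using assms(1,3) x by (simp add: carrier_integer_mod_group)
  then show ?thesis
    using assms(2) x by (cases "even m") (simp_all add: int_pow_neg)
qed

lemma cubes_D_Zp:
  assumes "0 < p"
  shows "cubes (D_Zp l p b) n =
    {c \<in> dcube n \<rightarrow>\<^sub>E Zp_points p b. \<forall>j. enat j < b \<longrightarrow> degree_le p l n (\<lambda>v. c v j)}"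
proof -
  have *: "(finprod (Zp_power p b)
        (\<lambda>v. c (\<phi> v) [^]\<^bsub>Zp_power p b\<^esub> ((-1::int) ^ nat (\<Sum>i<Suc l. v i))) (dcube (Suc l))
        = \<one>\<^bsub>Zp_power p b\<^esub>) \<longleftrightarrow>
      (\<forall>j. enat j < b \<longrightarrow> int p dvd signed_sum (Suc l) (\<lambda>v. c (\<phi> v) j))"
    if c: "c \<in> dcube n \<rightarrow>\<^sub>E Zp_points p b" and \<phi>: "\<phi> \<in> dcube_morphisms (Suc l) n" for c \<phi>
  proof -
    interpret comm_group "Zp_power p b" by (rule comm_group_Zp_power)
    let ?F = "\<lambda>v. c (\<phi> v) [^]\<^bsub>Zp_power p b\<^esub> ((-1::int) ^ nat (\<Sum>i<Suc l. v i))"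
    have mem: "c (\<phi> v) \<in> carrier (Zp_power p b)" if "v \<in> dcube (Suc l)" for v
      using PiE_mem[OF c dcube_morphisms_mem[OF \<phi> that]] assms by (simp add: carrier_Zp_power)
    then have F: "?F \<in> dcube (Suc l) \<rightarrow> carrier (Zp_power p b)"
      by (intro Pi_I int_pow_closed)
    have coord: "finprod (Zp_power p b) ?F (dcube (Suc l)) j =
        signed_sum (Suc l) (\<lambda>v. c (\<phi> v) j) mod int p" if j: "enat j < b" for j
    proof -
      have "finprod (Zp_power p b) ?F (dcube (Suc l)) j = (\<Sum>v\<in>dcube (Suc l). ?F v j) mod int p"
        by (rule finprod_Zp_power[OF finite_dcube F j])
      also have "(\<Sum>v\<in>dcube (Suc l). ?F v j) =
          (\<Sum>v\<in>dcube (Suc l). ((-1) ^ nat (\<Sum>i<Suc l. v i) * c (\<phi> v) j) mod int p)"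
        by (rule sum.cong[OF refl]) (rule sign_power_Zp_power[OF assms mem j])
      finally show ?thesis by (simp only: signed_sum_def mod_sum_eq)
    qed
    have "finprod (Zp_power p b) ?F (dcube (Suc l)) \<in> carrier (Zp_power p b)"
      using F by (rule finprod_closed)
    then have ext: "finprod (Zp_power p b) ?F (dcube (Suc l)) \<in> extensional {j. enat j < b}"
      by (simp add: Zp_power_def PiE_iff)
    have one: "\<one>\<^bsub>Zp_power p b\<^esub> = (\<lambda>j\<in>{j. enat j < b}. 0)"
      by (simp add: Zp_power_def)
    have "(finprod (Zp_power p b) ?F (dcube (Suc l)) = \<one>\<^bsub>Zp_power p b\<^esub>) \<longleftrightarrow>
        (\<forall>j. enat j < b \<longrightarrow> finprod (Zp_power p b) ?F (dcube (Suc l)) j = 0)"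
      unfolding one
    proof
      assume R: "\<forall>j. enat j < b \<longrightarrow> finprod (Zp_power p b) ?F (dcube (Suc l)) j = 0"
      show "finprod (Zp_power p b) ?F (dcube (Suc l)) = (\<lambda>j\<in>{j. enat j < b}. 0)"
        by (rule extensionalityI[OF ext]) (use R in simp_all)
    qed simp
    then show ?thesis by (simp add: coord mod_eq_0_iff_dvd del: sum.lessThan_Suc)
  qed
  show ?thesis
    unfolding D_space_def cubespace.simps carrier_Zp_power[OF assms] degree_le_def
    by (intro Collect_cong conj_cong refl) (use * in blast)
qed

lemma points_D_Zp: "0 < p \<Longrightarrow> points (D_Zp l p b) = Zp_points p b"
  by (simp add: D_space_def Zp_power_top_def carrier_integer_mod_group)

abbreviation prod_points :: "nat \<Rightarrow> (nat \<Rightarrow> enat) \<Rightarrow> nat \<Rightarrow> (nat \<Rightarrow> nat \<Rightarrow> int) set" where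
  "prod_points p a k \<equiv> \<Pi>\<^sub>E i\<in>{1..k}. Zp_points p (a i)"

lemma points_prod_D_Zp: "0 < p \<Longrightarrow> points (prod_D_Zp p a k) = prod_points p a k"
  unfolding prod_D_Zp_def product_cubespace_def
  by (simp add: points_D_Zp)

text \<open>The description of cubes used from here on: componentwise and coordinatewise degree bounds for
  integer functions, free of group operations.\<close>

lemma cubes_prod_D_Zp:
  assumes "0 < p"
  shows "cubes (prod_D_Zp p a k) n =
    {c \<in> dcube n \<rightarrow>\<^sub>E prod_points p a k.
       \<forall>i\<in>{1..k}. \<forall>j. enat j < a i \<longrightarrow> degree_le p i n (\<lambda>v. c v i j)}"
proof -
  have "(\<lambda>v\<in>dcube n. c v i) \<in> cubes (D_Zp i p (a i)) n \<longleftrightarrow>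
      (\<forall>j. enat j < a i \<longrightarrow> degree_le p i n (\<lambda>v. c v i j))"
    if c: "c \<in> dcube n \<rightarrow>\<^sub>E prod_points p a k" and i: "i \<in> {1..k}" for c i
  proof -
    have "c v i \<in> Zp_points p (a i)" if "v \<in> dcube n" for v
      using PiE_mem[OF PiE_mem[OF c that] i] .
    moreover have "degree_le p i n (\<lambda>v. (\<lambda>v\<in>dcube n. c v i) v j) \<longleftrightarrow>
        degree_le p i n (\<lambda>v. c v i j)" for j
    proof
      assume "degree_le p i n (\<lambda>v. (\<lambda>v\<in>dcube n. c v i) v j)"
      then show "degree_le p i n (\<lambda>v. c v i j)" by (rule degree_le_cong_mod) simp
    next
      assume "degree_le p i n (\<lambda>v. c v i j)"
      then show "degree_le p i n (\<lambda>v. (\<lambda>v\<in>dcube n. c v i) v j)" by (rule degree_le_cong_mod) simp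
    qed
    ultimately show ?thesis
      by (simp only: cubes_D_Zp[OF assms] mem_Collect_eq restrict_PiE_iff) blast
  qed
  then show ?thesis
    unfolding prod_D_Zp_def product_cubespace_def points_D_Zp[OF assms] cubespace.simps
    by (intro Collect_cong conj_cong ball_cong) simp_all
qed

lemma mult_prod_Zp_group:
  "x \<otimes>\<^bsub>prod_Zp_group p a k\<^esub> y =
     (\<lambda>i\<in>{1..k}. \<lambda>j\<in>{j. enat j < a i}. (x i j + y i j) mod int p)"
  by (simp add: prod_Zp_group_def mult_Zp_power)

section \<open>Displacements of cube-preserving maps\<close>

context
  fixes p :: nat and a :: "nat \<Rightarrow> enat"
  assumes p: "0 < p"
begin

lemma prod_points_coord:
  "x \<in> prod_points p a k \<Longrightarrow> i \<in> {1..k} \<Longrightarrow> enat j < a i \<Longrightarrow> 0 \<le> x i j \<and> x i j < int p"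
  by (auto simp: PiE_iff)

lemma Zp_points_eqI:
  assumes "x \<in> Zp_points p b" "y \<in> Zp_points p b"
    and "\<And>j. enat j < b \<Longrightarrow> int p dvd x j - y j"
  shows "x = y"
proof (rule PiE_ext[OF assms(1,2)])
  fix j assume j: "j \<in> {j. enat j < b}"
  then have "x j mod int p = y j mod int p" using assms(3) by (simp only: mod_eq_dvd_iff mem_Collect_eq)
  then show "x j = y j" using PiE_mem[OF assms(1) j] PiE_mem[OF assms(2) j] by simp
qed

lemma degree_le_cube:
  "c \<in> cubes (prod_D_Zp p a k) n \<Longrightarrow> i \<in> {1..k} \<Longrightarrow> enat j < a i \<Longrightarrow> degree_le p i n (\<lambda>v. c v i j)"
  by (simp add: cubes_prod_D_Zp[OF p])

lemma cube_mem: "c \<in> cubes (prod_D_Zp p a k) n \<Longrightarrow> v \<in> dcube n \<Longrightarrow> c v \<in> prod_points p a k"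
  unfolding cubes_prod_D_Zp[OF p] mem_Collect_eq by (elim conjE) (drule (1) PiE_mem)

lemma cubeI:
  assumes "\<And>v. v \<in> dcube n \<Longrightarrow> f v \<in> prod_points p a k"
    and "\<And>i j. i \<in> {1..k} \<Longrightarrow> enat j < a i \<Longrightarrow> degree_le p i n (\<lambda>v. f v i j)"
  shows "(\<lambda>v\<in>dcube n. f v) \<in> cubes (prod_D_Zp p a k) n"
  unfolding cubes_prod_D_Zp[OF p] mem_Collect_eq
proof (intro conjI ballI allI impI)
  show "restrict f (dcube n) \<in> dcube n \<rightarrow>\<^sub>E prod_points p a k"
    unfolding restrict_PiE_iff using assms(1) by blast
  show "degree_le p i n (\<lambda>v. (\<lambda>v\<in>dcube n. f v) v i j)" if "i \<in> {1..k}" "enat j < a i" for i j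
    using assms(2)[OF that] by (rule degree_le_cong_mod) simp
qed

lemma D_Zp_cubeI:
  assumes "\<And>v. v \<in> dcube n \<Longrightarrow> f v \<in> Zp_points p b"
    and "\<And>j. enat j < b \<Longrightarrow> degree_le p l n (\<lambda>v. f v j)"
  shows "(\<lambda>v\<in>dcube n. f v) \<in> cubes (D_Zp l p b) n"
  unfolding cubes_D_Zp[OF p] mem_Collect_eq
proof (intro conjI ballI allI impI)
  show "restrict f (dcube n) \<in> dcube n \<rightarrow>\<^sub>E Zp_points p b"
    unfolding restrict_PiE_iff using assms(1) by blast
  show "degree_le p l n (\<lambda>v. (\<lambda>v\<in>dcube n. f v) v j)" if "enat j < b" for j
    using assms(2)[OF that] by (rule degree_le_cong_mod) simp
qed

text \<open>Modifying a cube \<open>c\<close> by \<open>\<alpha>\<close> on a face \<open>F\<close> adds \<open>1\<^sub>F \<cdot> (\<alpha> \<circ> c - c)\<close>. Multiplication by \<open>1\<^sub>F\<close> raises degrees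
  by at most one, which gives sufficiency of the bound \<open>i - 1\<close>. It is necessary because \<open>c\<close> may be regarded as a
  cube of one dimension more that ignores the new coordinate \<open>w\<close>; on the face \<open>w = 1\<close> the added term is
  \<open>w (\<alpha> \<circ> c - c)\<close>, whose degree is at most \<open>i\<close> only if that of \<open>\<alpha> \<circ> c - c\<close> is at most \<open>i - 1\<close>.\<close>

lemma preserves_cubes_on_faces_iff:
  assumes \<alpha>: "\<alpha> \<in> prod_points p a k \<rightarrow> prod_points p a k"
  shows "preserves_cubes_on_faces (prod_D_Zp p a k) \<alpha> \<longleftrightarrow>
    (\<forall>n. \<forall>c\<in>cubes (prod_D_Zp p a k) n. \<forall>i\<in>{1..k}. \<forall>j. enat j < a i \<longrightarrow>
       degree_le p (i - 1) n (\<lambda>v. \<alpha> (c v) i j - c v i j))"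
    (is "?L \<longleftrightarrow> ?R")
proof
  assume L: ?L
  show ?R
  proof (intro allI ballI impI)
    fix n c i j assume c: "c \<in> cubes (prod_D_Zp p a k) n" and i: "i \<in> {1..k}" and j: "enat j < a i"
    define c' where "c' = (\<lambda>v\<in>dcube (Suc n). c (restrict v {..<n}))"
    have c': "c' \<in> cubes (prod_D_Zp p a k) (Suc n)"
      unfolding c'_def
    proof (rule cubeI)
      show "c (restrict v {..<n}) \<in> prod_points p a k" if "v \<in> dcube (Suc n)" for v
        by (rule cube_mem[OF c restrict_dcube[OF that]])
      show "degree_le p i (Suc n) (\<lambda>v. c (restrict v {..<n}) i j)" if "i \<in> {1..k}" "enat j < a i" for i j
        by (rule degree_le_cong_mod[OF degree_le_compose[OF degree_le_cube[OF c that] forget_last_morphism]]) simp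
    qed
    then have "apply_on_face (Suc n) n 1 \<alpha> c' \<in> cubes (prod_D_Zp p a k) (Suc n)"
      using L by (simp add: preserves_cubes_on_faces_def)
    then have "degree_le p (Suc (i - 1)) (Suc n)
        (\<lambda>v. apply_on_face (Suc n) n 1 \<alpha> c' v i j - c' v i j)"
      using degree_le_diff[OF degree_le_cube[OF _ i j] degree_le_cube[OF c' i j]] i by simp
    then
    have "degree_le p (Suc (i - 1)) (Suc n) (\<lambda>v. if v n = 1
        then \<alpha> (c (restrict v {..<n})) i j - c (restrict v {..<n}) i j else 0)"
      by (rule degree_le_cong_mod) (simp add: apply_on_face_def c'_def)
    then show "degree_le p (i - 1) n (\<lambda>v. \<alpha> (c v) i j - c v i j)"
      by (rule degree_le_of_last_coordinate_multiple)
  qed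
next
  assume R: ?R
  show ?L
    unfolding preserves_cubes_on_faces_def apply_on_face_def
  proof (intro allI ballI impI)
    fix n c q e assume c: "c \<in> cubes (prod_D_Zp p a k) n" and q: "q < n"
    show "(\<lambda>v\<in>dcube n. if v q = e then \<alpha> (c v) else c v) \<in> cubes (prod_D_Zp p a k) n"
    proof (rule cubeI)
      show "(if v q = e then \<alpha> (c v) else c v) \<in> prod_points p a k" if "v \<in> dcube n" for v
        using cube_mem[OF c that] funcset_mem[OF \<alpha> cube_mem[OF c that]]
        by (cases "v q = e") (simp_all only: if_True if_False simp_thms)
      fix i j assume i: "i \<in> {1..k}" and j: "enat j < a i"
      have "degree_le p (i - 1) n (\<lambda>v. \<alpha> (c v) i j - c v i j)" using R c i j by blast
      from degree_le_face_indicator[OF this q, of e]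
      have "degree_le p i n (\<lambda>v. if v q = e then \<alpha> (c v) i j - c v i j else 0)" using i by simp
      from degree_le_add[OF degree_le_cube[OF c i j] this]
      show "degree_le p i n (\<lambda>v. (if v q = e then \<alpha> (c v) else c v) i j)"
        by (rule degree_le_cong_mod) simp
    qed
  qed
qed

text \<open>Consider the map on the \<open>i\<close>-dimensional cube that equals \<open>y\<close> at the top vertex and \<open>x\<close> elsewhere. It is a cube of
  the product: its components below \<open>i\<close> are constant, and on a cube of dimension \<open>i\<close> every function
  has degree at most \<open>i\<close>. On it the \<open>i\<close>-th component of \<open>\<alpha> - id\<close> has degree at most \<open>i - 1\<close> and is constant
  off the top vertex, hence constant.\<close>

lemma difference_depends_on_lower_components:
  assumes \<alpha>: "\<alpha> \<in> prod_points p a k \<rightarrow> prod_points p a k"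
    and pres: "preserves_cubes_on_faces (prod_D_Zp p a k) \<alpha>"
    and x: "x \<in> prod_points p a k" and y: "y \<in> prod_points p a k"
    and eq: "\<And>i'. i' \<in> {1..<i} \<Longrightarrow> x i' = y i'"
    and i: "i \<in> {1..k}" and j: "enat j < a i"
  shows "int p dvd (\<alpha> y i j - y i j) - (\<alpha> x i j - x i j)"
proof -
  let ?one = "\<lambda>i'\<in>{..<i}. 1::int"
  define c where "c = (\<lambda>v\<in>dcube i. if v = ?one then y else x)"
  have "c \<in> cubes (prod_D_Zp p a k) i"
    unfolding c_def
  proof (rule cubeI)
    fix i' j' assume i': "i' \<in> {1..k}" "enat j' < a i'"
    show "degree_le p i' i (\<lambda>v. (if v = ?one then y else x) i' j')"
    proof (cases "i' < i")
      case True
      then have "x i' = y i'" using eq i' by simp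
      then show ?thesis by (intro degree_le_cong_mod[OF degree_le_const[of p i' i "x i' j'"]]) simp
    qed (simp add: degree_le_dimension)
  qed (use x y in simp)
  then have "degree_le p (i - 1) i (\<lambda>v. \<alpha> (c v) i j - c v i j)"
    using pres i j unfolding preserves_cubes_on_faces_iff[OF \<alpha>] by blast
  from degree_le_diff[OF this degree_le_const[of _ _ _ "\<alpha> x i j - x i j"]]
  have "degree_le p (i - 1) i (\<lambda>v. if v = ?one then (\<alpha> y i j - y i j) - (\<alpha> x i j - x i j) else 0)"
    by (rule degree_le_cong_mod) (simp add: c_def)
  then show ?thesis using degree_le_corner[of p "i - 1"] i by simp
qed

section \<open>Reading off the parameters of a translation\<close>

definition zero_extend :: "nat \<Rightarrow> nat \<Rightarrow> (nat \<Rightarrow> nat \<Rightarrow> int) \<Rightarrow> nat \<Rightarrow> nat \<Rightarrow> int" where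
  "zero_extend k m y = (\<lambda>i\<in>{1..k}. if i \<le> m then y i else (\<lambda>j\<in>{j. enat j < a i}. 0))"

lemma zero_extend_points: "y \<in> prod_points p a m \<Longrightarrow> zero_extend k m y \<in> prod_points p a k"
  unfolding zero_extend_def restrict_PiE_iff using p by (auto simp: PiE_iff)

lemma zero_extend_cube:
  assumes c: "c \<in> cubes (prod_D_Zp p a m) n"
  shows "(\<lambda>v\<in>dcube n. zero_extend k m (c v)) \<in> cubes (prod_D_Zp p a k) n"
proof (rule cubeI)
  show "zero_extend k m (c v) \<in> prod_points p a k" if "v \<in> dcube n" for v
    by (rule zero_extend_points[OF cube_mem[OF c that]])
  fix i j assume i: "i \<in> {1..k}" "enat j < a i"
  show "degree_le p i n (\<lambda>v. zero_extend k m (c v) i j)"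
    using degree_le_cube[OF c, of i j] i degree_le_const[of p i n 0]
    by (cases "i \<le> m") (simp_all add: zero_extend_def)
qed

lemma restrict_points: "x \<in> prod_points p a k \<Longrightarrow> m \<le> k \<Longrightarrow> restrict x {1..m} \<in> prod_points p a m"
  by (auto simp: PiE_iff)

text \<open>The candidate inverse of \<open>translation_of\<close>. At a point whose components from \<open>i\<close> on are zero, the
  \<open>i\<close>-th component of the image is the \<open>i\<close>-th component of the displacement, so no subtraction is
  needed. The constant \<open>\<lambda>_. undefined\<close> is the empty tuple, the only point of the product over \<open>{1..0}\<close>.\<close>

definition params_of ::
    "nat \<Rightarrow> ((nat \<Rightarrow> nat \<Rightarrow> int) \<Rightarrow> nat \<Rightarrow> nat \<Rightarrow> int) \<Rightarrow>
      (nat \<Rightarrow> int) \<times> (nat \<Rightarrow> (nat \<Rightarrow> nat \<Rightarrow> int) \<Rightarrow> nat \<Rightarrow> int)" where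
  "params_of k \<alpha> =
     (\<alpha> (zero_extend k 0 (\<lambda>_. undefined)) 1,
      \<lambda>i\<in>{2..k}. \<lambda>y\<in>prod_points p a (i - 1). \<alpha> (zero_extend k (i - 1) y) i)"

lemma top_of_D_Zp: "top_of (D_Zp l p b) = Zp_power_top p b"
  by (simp add: D_space_def)

lemma top_of_prod_D_Zp:
  "top_of (prod_D_Zp p a k) = product_topology (\<lambda>i. Zp_power_top p (a i)) {1..k}"
  by (simp add: prod_D_Zp_def product_cubespace_def D_space_def)

lemma topspace_prod: "topspace (top_of (prod_D_Zp p a k)) = prod_points p a k"
  by (rule points_prod_D_Zp[OF p])

lemma topspace_Zp_power_top: "topspace (Zp_power_top p b) = Zp_points p b"
  using points_D_Zp[OF p, of 0 b] by (simp add: top_of_D_Zp)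

lemma continuous_component:
  "i \<in> {1..k} \<Longrightarrow> continuous_map (top_of (prod_D_Zp p a k)) (Zp_power_top p (a i)) (\<lambda>x. x i)"
  unfolding top_of_prod_D_Zp by (rule continuous_map_product_projection)

lemma continuous_coordinate:
  assumes "enat j < b"
  shows "continuous_map (Zp_power_top p b) (discrete_topology {0..<int p}) (\<lambda>x. x j)"
  using continuous_map_product_projection[of j "{j. enat j < b}" "\<lambda>_. discrete_topology {0..<int p}"] assms p
  by (simp add: Zp_power_top_def carrier_integer_mod_group)

lemma continuous_zero_extend:
  "continuous_map (top_of (prod_D_Zp p a m)) (top_of (prod_D_Zp p a k)) (zero_extend k m)"
proof -
  have "continuous_map (top_of (prod_D_Zp p a m)) (Zp_power_top p (a i)) (\<lambda>y. zero_extend k m y i)"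
    if i: "i \<in> {1..k}" for i
  proof (cases "i \<le> m")
    case True
    then show ?thesis using i continuous_component[of i m] by (simp add: zero_extend_def)
  next
    case False
    then show ?thesis using i p by (simp add: zero_extend_def topspace_Zp_power_top)
  qed
  then show ?thesis
    unfolding top_of_prod_D_Zp[of k] continuous_map_componentwise
    by (auto simp: zero_extend_def)
qed

lemma continuous_restrict:
  assumes "m \<le> k"
  shows "continuous_map (top_of (prod_D_Zp p a k)) (top_of (prod_D_Zp p a m)) (\<lambda>x. restrict x {1..m})"
  unfolding top_of_prod_D_Zp[of m] continuous_map_componentwise
  using continuous_component[of _ k] assms by auto

text \<open>The maps read off from a translation \<open>\<alpha>\<close> are morphisms into \<open>\<D>\<^sub>i\<^sub>-\<^sub>1\<close> because \<open>\<alpha> - id\<close> lowers degrees, and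
  they are continuous as compositions of \<open>\<alpha>\<close> with extension by zero and a projection.\<close>

lemma params_of_mem:
  assumes k: "1 \<le> k" and \<alpha>: "\<alpha> \<in> Theta (prod_D_Zp p a k)"
  shows "params_of k \<alpha> \<in> translation_params p a k"
proof -
  have maps: "\<alpha> \<in> prod_points p a k \<rightarrow> prod_points p a k"
    using \<alpha> by (simp add: Theta_def translation_def topspace_prod bij_betw_imp_funcset)
  have pres: "preserves_cubes_on_faces (prod_D_Zp p a k) \<alpha>"
    using \<alpha> by (simp add: Theta_def translation_def)
  have cont: "continuous_map (top_of (prod_D_Zp p a k)) (top_of (prod_D_Zp p a k)) \<alpha>"
    using \<alpha> by (simp add: Theta_def homeomorphic_imp_continuous_map)
  have "zero_extend k 0 (\<lambda>_. undefined) \<in> prod_points p a k"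
    by (rule zero_extend_points) simp
  from PiE_mem[OF funcset_mem[OF maps this], of 1] have "\<alpha> (zero_extend k 0 (\<lambda>_. undefined)) 1 \<in> Zp_points p (a 1)"
    using k by simp
  moreover have "(\<lambda>y\<in>prod_points p a (i - 1). \<alpha> (zero_extend k (i - 1) y) i)
      \<in> cont_hom (prod_D_Zp p a (i - 1)) (D_Zp (i - 1) p (a i))" (is "?T \<in> _") if i: "i \<in> {2..k}" for i
  proof -
    have ik: "i \<in> {1..k}" using i by simp
    have val: "\<alpha> (zero_extend k (i - 1) y) i \<in> Zp_points p (a i)" if "y \<in> prod_points p a (i - 1)" for y
      by (rule PiE_mem[OF funcset_mem[OF maps zero_extend_points[OF that]] ik])
    have cubes: "compose (dcube n) ?T c \<in> cubes (D_Zp (i - 1) p (a i)) n"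
      if c: "c \<in> cubes (prod_D_Zp p a (i - 1)) n" for n c
      unfolding compose_def
    proof (rule D_Zp_cubeI)
      show "?T (c v) \<in> Zp_points p (a i)" if "v \<in> dcube n" for v
        using val[OF cube_mem[OF c that]] cube_mem[OF c that] by simp
      fix j assume j: "enat j < a i"
      let ?c = "\<lambda>v\<in>dcube n. zero_extend k (i - 1) (c v)"
      have "degree_le p (i - 1) n (\<lambda>v. \<alpha> (?c v) i j - ?c v i j)"
        using pres zero_extend_cube[OF c] ik j unfolding preserves_cubes_on_faces_iff[OF maps] by blast
      then show "degree_le p (i - 1) n (\<lambda>v. ?T (c v) j)"
      proof (rule degree_le_cong_mod)
        fix v assume v: "v \<in> dcube n"
        have "zero_extend k (i - 1) (c v) i j = 0" using ik i j by (simp add: zero_extend_def)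
        then show "int p dvd ?T (c v) j - (\<alpha> (?c v) i j - ?c v i j)"
          using v cube_mem[OF c v] by simp
      qed
    qed
    have T: "continuous_map (top_of (prod_D_Zp p a (i - 1))) (Zp_power_top p (a i)) ?T"
      by (rule continuous_map_eq[OF continuous_map_compose[OF
            continuous_map_compose[OF continuous_zero_extend cont] continuous_component[OF ik]]])
        (simp add: topspace_prod)
    show ?thesis
      unfolding cont_hom_def cubespace_morphism_def top_of_D_Zp topspace_prod topspace_Zp_power_top
        mem_Collect_eq restrict_PiE_iff
      by (intro conjI ballI allI val cubes T)
  qed
  ultimately show ?thesis
    unfolding params_of_def translation_params_def carrier_Zp_power[OF p] mem_Times_iff fst_conv snd_conv
      restrict_PiE_iff by blast
qed

section \<open>Triangular maps are translations\<close>

text \<open>The displacement \<open>(T\<^sub>1, T\<^sub>2(x\<^sub>1), \<dots>)\<close> as a function of the whole point, with \<open>T\<^sub>1\<close> treated on the same footing as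
  the other components.\<close>

definition shift ::
    "(nat \<Rightarrow> int) \<times> (nat \<Rightarrow> (nat \<Rightarrow> nat \<Rightarrow> int) \<Rightarrow> nat \<Rightarrow> int) \<Rightarrow>
      nat \<Rightarrow> (nat \<Rightarrow> nat \<Rightarrow> int) \<Rightarrow> nat \<Rightarrow> int" where
  "shift tT i x = (if i = 1 then fst tT else snd tT i (restrict x {1..i - 1}))"

lemma translation_of_eq:
  assumes "x \<in> prod_points p a k"
  shows "translation_of p a k tT x =
    (\<lambda>i\<in>{1..k}. \<lambda>j\<in>{j. enat j < a i}. (x i j + shift tT i x j) mod int p)"
  using assms
  by (cases tT) (auto simp: translation_of_def topspace_prod mult_prod_Zp_group shift_def intro!: restrict_ext)

lemma translation_of_coord:
  assumes "x \<in> prod_points p a k" "i \<in> {1..k}" "enat j < a i"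
  shows "translation_of p a k tT x i j = (x i j + shift tT i x j) mod int p"
  using assms by (simp add: translation_of_eq)

lemma translation_of_points:
  assumes "x \<in> prod_points p a k"
  shows "translation_of p a k tT x \<in> prod_points p a k"
  unfolding translation_of_eq[OF assms] restrict_PiE_iff using p by auto

lemma shift_cong:
  assumes "\<And>i'. i' \<in> {1..<i} \<Longrightarrow> x i' = y i'"
  shows "shift tT i x = shift tT i y"
proof -
  have "restrict x {1..i - 1} = restrict y {1..i - 1}"
    by (rule restrict_ext) (use assms in auto)
  then show ?thesis by (simp add: shift_def)
qed

lemma shift_zero_extend:
  assumes "i \<in> {2..k}" "y \<in> prod_points p a (i - 1)"
  shows "shift tT i (zero_extend k (i - 1) y) = snd tT i y"
proof -
  have "restrict (zero_extend k (i - 1) y) {1..i - 1} = y"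
    by (rule extensionalityI[of _ "{1..i - 1}"]) (use assms in \<open>auto simp: zero_extend_def PiE_iff\<close>)
  then show ?thesis using assms by (cases tT) (simp add: shift_def)
qed

lemma translation_params_component:
  assumes "tT \<in> translation_params p a k" "i \<in> {2..k}"
  shows "snd tT i \<in> cont_hom (prod_D_Zp p a (i - 1)) (D_Zp (i - 1) p (a i))"
  using assms by (intro PiE_mem[of "snd tT" "{2..k}"]) (auto simp: translation_params_def)

lemma shift_mem:
  assumes tT: "tT \<in> translation_params p a k" and x: "x \<in> prod_points p a k" and i: "i \<in> {1..k}"
  shows "shift tT i x \<in> Zp_points p (a i)"
proof (cases "i = 1")
  case True
  then show ?thesis
    using tT by (auto simp: shift_def translation_params_def carrier_Zp_power[OF p])
next
  case False
  then have "snd tT i \<in> cont_hom (prod_D_Zp p a (i - 1)) (D_Zp (i - 1) p (a i))"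
    using i by (intro translation_params_component[OF tT]) auto
  then have "snd tT i \<in> prod_points p a (i - 1) \<rightarrow>\<^sub>E Zp_points p (a i)"
    unfolding cont_hom_def cubespace_morphism_def topspace_prod top_of_D_Zp topspace_Zp_power_top by blast
  moreover have "i - 1 \<le> k" using i by auto
  ultimately have "snd tT i (restrict x {1..i - 1}) \<in> Zp_points p (a i)"
    by (rule PiE_mem[OF _ restrict_points[OF x]])
  then show ?thesis using False by (simp only: shift_def if_False)
qed

lemma shift_degree:
  assumes tT: "tT \<in> translation_params p a k" and i: "i \<in> {1..k}" and j: "enat j < a i"
    and c: "(\<lambda>v\<in>dcube n. restrict (f v) {1..i - 1}) \<in> cubes (prod_D_Zp p a (i - 1)) n"
  shows "degree_le p (i - 1) n (\<lambda>v. shift tT i (f v) j)"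
proof (cases "i = 1")
  case True
  then show ?thesis by (simp add: shift_def degree_le_const)
next
  case False
  then have "snd tT i \<in> cont_hom (prod_D_Zp p a (i - 1)) (D_Zp (i - 1) p (a i))"
    using i by (intro translation_params_component[OF tT]) auto
  then have "compose (dcube n) (snd tT i) (\<lambda>v\<in>dcube n. restrict (f v) {1..i - 1})
      \<in> cubes (D_Zp (i - 1) p (a i)) n"
    using c unfolding cont_hom_def cubespace_morphism_def by blast
  then have "degree_le p (i - 1) n
      (\<lambda>v. compose (dcube n) (snd tT i) (\<lambda>v\<in>dcube n. restrict (f v) {1..i - 1}) v j)"
    using j unfolding cubes_D_Zp[OF p] by blast
  then show ?thesis
    by (rule degree_le_cong_mod) (use False in \<open>simp add: compose_def shift_def\<close>)
qed

lemma shift_continuous: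
  assumes tT: "tT \<in> translation_params p a k" and i: "i \<in> {1..k}"
  shows "continuous_map (top_of (prod_D_Zp p a k)) (Zp_power_top p (a i)) (shift tT i)"
proof (cases "i = 1")
  case True
  have "fst tT \<in> Zp_points p (a 1)"
    using tT by (auto simp: translation_params_def carrier_Zp_power[OF p])
  moreover have "shift tT i = (\<lambda>x. fst tT)" using True by (auto simp: shift_def)
  ultimately show ?thesis using True by (simp add: topspace_Zp_power_top)
next
  case False
  then have "snd tT i \<in> cont_hom (prod_D_Zp p a (i - 1)) (D_Zp (i - 1) p (a i))"
    using i by (intro translation_params_component[OF tT]) auto
  then have T: "continuous_map (top_of (prod_D_Zp p a (i - 1))) (Zp_power_top p (a i)) (snd tT i)"
    by (simp add: cont_hom_def top_of_D_Zp)
  have "i - 1 \<le> k" using i by auto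
  from continuous_map_compose[OF continuous_restrict[OF this] T] show ?thesis
    by (rule continuous_map_eq) (use False in \<open>simp add: shift_def\<close>)
qed

text \<open>The displacement of component \<open>i\<close> depends only on lower components, so the components can be
  recovered from the image one after the other.\<close>

lemma translation_of_inj:
  assumes tT: "tT \<in> translation_params p a k"
  shows "inj_on (translation_of p a k tT) (prod_points p a k)"
proof (rule inj_onI)
  fix x y assume x: "x \<in> prod_points p a k" and y: "y \<in> prod_points p a k"
    and eq: "translation_of p a k tT x = translation_of p a k tT y"
  have "x i = y i" if "i \<in> {1..k}" for i
    using that
  proof (induction i rule: less_induct)
    case (less i)
    have shift_eq: "shift tT i x = shift tT i y"
      by (rule shift_cong) (use less in auto)
    show ?case
    proof (rule Zp_points_eqI[OF PiE_mem[OF x less.prems] PiE_mem[OF y less.prems]])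
      fix j assume j: "enat j < a i"
      have "(x i j + shift tT i x j) mod int p = (y i j + shift tT i y j) mod int p"
        using translation_of_coord[OF x less.prems j, of tT]
          translation_of_coord[OF y less.prems j, of tT] eq by simp
      then show "int p dvd x i j - y i j"
        by (simp add: shift_eq mod_eq_dvd_iff)
    qed
  qed
  then show "x = y" by (rule PiE_ext[OF x y])
qed

text \<open>Solve the triangular system \<open>x\<^sub>i + T\<^sub>i(x\<^sub>1, \<dots>, x\<^sub>i\<^sub>-\<^sub>1) = y\<^sub>i\<close> for one component at a time; replacing
  \<open>x\<close> at \<open>m + 1\<close> does not disturb the equations already solved.\<close>

lemma translation_of_surj:
  assumes tT: "tT \<in> translation_params p a k" and y: "y \<in> prod_points p a k"
  shows "\<exists>x\<in>prod_points p a k. translation_of p a k tT x = y"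
proof -
  have "\<exists>x\<in>prod_points p a k. \<forall>i\<in>{1..m}. translation_of p a k tT x i = y i" if "m \<le> k" for m
    using that
  proof (induction m)
    case 0
    show ?case using y by (intro bexI[of _ y]) simp_all
  next
    case (Suc m)
    then obtain x where x: "x \<in> prod_points p a k"
      and IH: "\<And>i. i \<in> {1..m} \<Longrightarrow> translation_of p a k tT x i = y i" by auto
    have m: "Suc m \<in> {1..k}" using Suc.prems by simp
    define z where "z = (\<lambda>j\<in>{j. enat j < a (Suc m)}. (y (Suc m) j - shift tT (Suc m) x j) mod int p)"
    define x' where "x' = x(Suc m := z)"
    have z: "z \<in> Zp_points p (a (Suc m))"
      unfolding z_def restrict_PiE_iff using p by simp
    have x': "x' \<in> prod_points p a k"
    proof (rule PiE_I)
      show "x' i \<in> Zp_points p (a i)" if "i \<in> {1..k}" for i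
        using PiE_mem[OF x that] z by (cases "i = Suc m") (simp_all only: x'_def fun_upd_same fun_upd_other not_False_eq_True)
      show "x' i = undefined" if "i \<notin> {1..k}" for i
        using PiE_arb[OF x that] that m by (cases "i = Suc m") (simp_all add: x'_def)
    qed
    have shift_eq: "shift tT i x' = shift tT i x" if "i \<le> Suc m" for i
      by (rule shift_cong) (use that in \<open>simp add: x'_def\<close>)
    have "translation_of p a k tT x' i = y i" if i: "i \<in> {1..Suc m}" for i
    proof (cases "i = Suc m")
      case True
      have "translation_of p a k tT x' (Suc m) = y (Suc m)"
      proof (rule Zp_points_eqI[OF PiE_mem[OF translation_of_points[OF x'] m] PiE_mem[OF y m]])
        fix j assume j: "enat j < a (Suc m)"
        have "translation_of p a k tT x' (Suc m) j =
            ((y (Suc m) j - shift tT (Suc m) x j) mod int p + shift tT (Suc m) x j) mod int p"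
          unfolding translation_of_coord[OF x' m j] shift_eq[OF order_refl]
          using j by (simp add: x'_def z_def)
        also have "\<dots> = y (Suc m) j mod int p" by (simp add: mod_add_left_eq)
        finally show "int p dvd translation_of p a k tT x' (Suc m) j - y (Suc m) j"
          by (simp add: mod_eq_dvd_iff[symmetric])
      qed
      then show ?thesis using True by simp
    next
      case False
      then have i': "i \<in> {1..m}" using i by auto
      have "x' i = x i" "shift tT i x' = shift tT i x"
        using False i shift_eq by (simp_all add: x'_def)
      then have "translation_of p a k tT x' i = translation_of p a k tT x i"
        unfolding translation_of_eq[OF x'] translation_of_eq[OF x] by (simp cong: if_cong)
      then show ?thesis using IH[OF i'] by simp
    qed
    then show ?case using x' by blast
  qed
  from this[OF order_refl] obtain x where x: "x \<in> prod_points p a k"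
    and eq: "\<And>i. i \<in> {1..k} \<Longrightarrow> translation_of p a k tT x i = y i" by blast
  have "translation_of p a k tT x = y"
    by (rule PiE_ext[OF translation_of_points[OF x] y eq])
  with x show ?thesis by blast
qed

lemma translation_of_bij:
  assumes "tT \<in> translation_params p a k"
  shows "bij_betw (translation_of p a k tT) (prod_points p a k) (prod_points p a k)"
  unfolding bij_betw_def
proof (intro conjI equalityI subsetI)
  show "inj_on (translation_of p a k tT) (prod_points p a k)"
    by (rule translation_of_inj[OF assms])
  show "y \<in> prod_points p a k" if "y \<in> translation_of p a k tT ` prod_points p a k" for y
    using that by (rule imageE) (simp only: translation_of_points)
  show "y \<in> translation_of p a k tT ` prod_points p a k" if "y \<in> prod_points p a k" for y
    using translation_of_surj[OF assms that] by (elim bexE) (rule image_eqI[OF sym])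
qed

lemma restrict_cube:
  assumes "c \<in> cubes (prod_D_Zp p a k) n" "m \<le> k"
  shows "(\<lambda>v\<in>dcube n. restrict (c v) {1..m}) \<in> cubes (prod_D_Zp p a m) n"
proof (rule cubeI)
  show "restrict (c v) {1..m} \<in> prod_points p a m" if "v \<in> dcube n" for v
    by (rule restrict_points[OF cube_mem[OF assms(1) that] assms(2)])
  show "degree_le p i n (\<lambda>v. restrict (c v) {1..m} i j)" if "i \<in> {1..m}" "enat j < a i" for i j
    using degree_le_cube[OF assms(1), of i j] that assms(2) by simp
qed

lemma translation_of_preserves:
  assumes tT: "tT \<in> translation_params p a k"
  shows "preserves_cubes_on_faces (prod_D_Zp p a k) (translation_of p a k tT)"
proof -
  have maps: "translation_of p a k tT \<in> prod_points p a k \<rightarrow> prod_points p a k"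
    by (rule funcsetI) (rule translation_of_points)
  show ?thesis
    unfolding preserves_cubes_on_faces_iff[OF maps]
  proof (intro allI ballI impI)
    fix n c i j assume c: "c \<in> cubes (prod_D_Zp p a k) n" and i: "i \<in> {1..k}" and j: "enat j < a i"
    have "i - 1 \<le> k" using i by auto
    from shift_degree[OF tT i j restrict_cube[OF c this]]
    show "degree_le p (i - 1) n (\<lambda>v. translation_of p a k tT (c v) i j - c v i j)"
    proof (rule degree_le_cong_mod)
      fix v assume "v \<in> dcube n"
      show "int p dvd translation_of p a k tT (c v) i j - c v i j - shift tT i (c v) j"
        unfolding translation_of_coord[OF cube_mem[OF c \<open>v \<in> dcube n\<close>] i j]
        by (simp add: mod_eq_dvd_iff[symmetric] mod_diff_left_eq mod_diff_eq diff_diff_add)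
    qed
  qed
qed

text \<open>The inverse \<open>\<beta>\<close> has displacement \<open>-T\<^sub>i(\<beta>(y)\<^sub>1, \<dots>, \<beta>(y)\<^sub>i\<^sub>-\<^sub>1)\<close>, so the degree bound follows once the truncations
  of \<open>\<beta> \<circ> c\<close> are known to be cubes. This is proved by induction on the length of the truncation: component \<open>m + 1\<close> is
  a function of degree at most \<open>m + 1\<close> minus one of degree at most \<open>m\<close>.\<close>

lemma inverse_preserves:
  assumes tT: "tT \<in> translation_params p a k"
  shows "preserves_cubes_on_faces (prod_D_Zp p a k)
    (inv_into (prod_points p a k) (translation_of p a k tT))"
proof -
  define \<beta> where "\<beta> = inv_into (prod_points p a k) (translation_of p a k tT)"
  have maps: "\<beta> \<in> prod_points p a k \<rightarrow> prod_points p a k"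
    unfolding \<beta>_def by (rule bij_betw_imp_funcset[OF bij_betw_inv_into[OF translation_of_bij[OF tT]]])
  have right_inv: "translation_of p a k tT (\<beta> y) = y" if "y \<in> prod_points p a k" for y
    unfolding \<beta>_def by (rule bij_betw_inv_into_right[OF translation_of_bij[OF tT] that])
  have eq: "int p dvd y i j - (\<beta> y i j + shift tT i (\<beta> y) j)"
    if y: "y \<in> prod_points p a k" and i: "i \<in> {1..k}" and j: "enat j < a i" for y i j
    using translation_of_coord[OF funcset_mem[OF maps y] i j, of tT]
    unfolding right_inv[OF y]
    using prod_points_coord[OF y i j] by (simp add: mod_eq_dvd_iff[symmetric])
  have cube: "(\<lambda>v\<in>dcube n. restrict (\<beta> (c v)) {1..m}) \<in> cubes (prod_D_Zp p a m) n"
    if c: "c \<in> cubes (prod_D_Zp p a k) n" and "m \<le> k" for n c m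
    using \<open>m \<le> k\<close>
  proof (induction m)
    case 0
    show ?case
    proof (rule cubeI)
      show "restrict (\<beta> (c v)) {1..0} \<in> prod_points p a 0" for v by (simp add: restrict_def)
    qed simp
  next
    case (Suc m)
    note IH = Suc.IH[OF Suc_leD[OF Suc.prems]]
    show ?case
    proof (rule cubeI)
      show "restrict (\<beta> (c v)) {1..Suc m} \<in> prod_points p a (Suc m)" if "v \<in> dcube n" for v
        by (rule restrict_points[OF funcset_mem[OF maps cube_mem[OF c that]] Suc.prems])
      fix i j assume i: "i \<in> {1..Suc m}" and j: "enat j < a i"
      show "degree_le p i n (\<lambda>v. restrict (\<beta> (c v)) {1..Suc m} i j)"
      proof (cases "i = Suc m")
        case False
        then have i': "i \<in> {1..m}" using i by auto
        from degree_le_cube[OF IH this j] show ?thesis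
          by (rule degree_le_cong_mod) (use i' in simp)
      next
        case True
        then have ik: "i \<in> {1..k}" using Suc.prems by simp
        have "degree_le p (i - 1) n (\<lambda>v. shift tT i (\<beta> (c v)) j)"
          by (rule shift_degree[OF tT ik j]) (unfold True diff_Suc_1, rule IH)
        then have "degree_le p i n (\<lambda>v. shift tT i (\<beta> (c v)) j)"
          by (rule degree_le_mono) simp
        from degree_le_diff[OF degree_le_cube[OF c ik j] this] show ?thesis
        proof (rule degree_le_cong_mod)
          fix v assume v: "v \<in> dcube n"
          have "int p dvd - (c v i j - (\<beta> (c v) i j + shift tT i (\<beta> (c v)) j))"
            using eq[OF cube_mem[OF c v] ik j] by (simp only: dvd_minus_iff)
          then show "int p dvd restrict (\<beta> (c v)) {1..Suc m} i j - (c v i j - shift tT i (\<beta> (c v)) j)"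
            using i by (simp add: algebra_simps)
        qed
      qed
    qed
  qed
  have "preserves_cubes_on_faces (prod_D_Zp p a k) \<beta>"
    unfolding preserves_cubes_on_faces_iff[OF maps]
  proof (intro allI ballI impI)
    fix n c i j assume c: "c \<in> cubes (prod_D_Zp p a k) n" and i: "i \<in> {1..k}" and j: "enat j < a i"
    have "i - 1 \<le> k" using i by auto
    from shift_degree[OF tT i j cube[OF c this]]
    have "degree_le p (i - 1) n (\<lambda>v. 0 - shift tT i (\<beta> (c v)) j)"
      by (rule degree_le_diff[OF degree_le_const])
    then show "degree_le p (i - 1) n (\<lambda>v. \<beta> (c v) i j - c v i j)"
    proof (rule degree_le_cong_mod)
      fix v assume v: "v \<in> dcube n"
      have "int p dvd - (c v i j - (\<beta> (c v) i j + shift tT i (\<beta> (c v)) j))"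
        using eq[OF cube_mem[OF c v] i j] by (simp only: dvd_minus_iff)
      then show "int p dvd \<beta> (c v) i j - c v i j - (0 - shift tT i (\<beta> (c v)) j)"
        by (simp add: algebra_simps)
    qed
  qed
  then show ?thesis by (simp only: \<beta>_def)
qed

text \<open>Continuity may be tested on each coordinate in \<open>\<int>\<^sub>p\<close>. There, addition is continuous because the
  product of two discrete spaces is discrete.\<close>

lemma translation_of_continuous:
  assumes tT: "tT \<in> translation_params p a k"
  shows "continuous_map (top_of (prod_D_Zp p a k)) (top_of (prod_D_Zp p a k)) (translation_of p a k tT)"
proof -
  let ?X = "top_of (prod_D_Zp p a k)"
  let ?D = "discrete_topology {0..<int p}"
  have coord: "continuous_map ?X ?D (\<lambda>x. translation_of p a k tT x i j)"
    if i: "i \<in> {1..k}" and j: "enat j < a i" for i j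
  proof -
    have "continuous_map ?X (prod_topology ?D ?D) (\<lambda>x. (x i j, shift tT i x j))"
      using continuous_map_compose[OF continuous_component[OF i] continuous_coordinate[OF j]]
        continuous_map_compose[OF shift_continuous[OF tT i] continuous_coordinate[OF j]]
      unfolding comp_def by (rule continuous_map_pairedI)
    moreover have "continuous_map (prod_topology ?D ?D) ?D (\<lambda>(u, w). (u + w) mod int p)"
      unfolding prod_topology_discrete_topology[symmetric] using p by auto
    ultimately have "continuous_map ?X ?D ((\<lambda>(u, w). (u + w) mod int p) \<circ> (\<lambda>x. (x i j, shift tT i x j)))"
      by (rule continuous_map_compose)
    then show ?thesis
      by (rule continuous_map_eq) (simp add: topspace_prod translation_of_coord[OF _ i j])
  qed
  have "continuous_map ?X (Zp_power_top p (a i)) (\<lambda>x. translation_of p a k tT x i)"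
    if i: "i \<in> {1..k}" for i
  proof -
    have "(\<lambda>x. translation_of p a k tT x i) ` topspace ?X \<subseteq> extensional {j. enat j < a i}"
      unfolding topspace_prod
    proof (rule image_subsetI)
      fix x assume "x \<in> prod_points p a k"
      from PiE_mem[OF translation_of_points[OF this] i]
      show "translation_of p a k tT x i \<in> extensional {j. enat j < a i}"
        by (simp only: PiE_def Int_iff)
    qed
    then show ?thesis
      unfolding Zp_power_top_def continuous_map_componentwise
      using coord[OF i] p by (simp add: carrier_integer_mod_group)
  qed
  moreover have "translation_of p a k tT ` topspace ?X \<subseteq> extensional {1..k}"
    unfolding topspace_prod
  proof (rule image_subsetI)
    fix x assume "x \<in> prod_points p a k"
    from translation_of_points[OF this] show "translation_of p a k tT x \<in> extensional {1..k}"
      by (simp only: PiE_def Int_iff)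
  qed
  ultimately show ?thesis
    by (subst (2) top_of_prod_D_Zp) (simp only: continuous_map_componentwise ball_simps simp_thms, blast)
qed

lemma compact_prod_D_Zp: "compact_space (top_of (prod_D_Zp p a k))"
  unfolding top_of_prod_D_Zp Zp_power_top_def
  using p by (auto simp: compact_space_product_topology compact_space_discrete_topology carrier_integer_mod_group)

lemma Hausdorff_prod_D_Zp: "Hausdorff_space (top_of (prod_D_Zp p a k))"
  unfolding top_of_prod_D_Zp Zp_power_top_def
  by (simp add: Hausdorff_space_product_topology)

text \<open>A continuous bijection from a compact space to a Hausdorff space is a homeomorphism, so the
  inverse needs no separate continuity argument.\<close>

lemma translation_of_mem:
  assumes tT: "tT \<in> translation_params p a k"
  shows "translation_of p a k tT \<in> Theta (prod_D_Zp p a k)"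
proof -
  have "homeomorphic_map (top_of (prod_D_Zp p a k)) (top_of (prod_D_Zp p a k)) (translation_of p a k tT)"
    using translation_of_bij[OF tT] unfolding bij_betw_def
    by (intro continuous_imp_homeomorphic_map translation_of_continuous[OF tT]
        compact_prod_D_Zp Hausdorff_prod_D_Zp) (simp_all add: topspace_prod)
  moreover have "translation_of p a k tT \<in> extensional (prod_points p a k)"
    by (simp add: translation_of_def topspace_prod split: prod.split)
  ultimately show ?thesis
    unfolding Theta_def translation_def topspace_prod
    using translation_of_bij[OF tT] translation_of_preserves[OF tT] inverse_preserves[OF tT] by blast
qed

section \<open>The correspondence\<close>

lemma params_of_translation_of:
  assumes k: "1 \<le> k" and tT: "tT \<in> translation_params p a k"
  shows "params_of k (translation_of p a k tT) = tT"
proof -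
  have component: "translation_of p a k tT (zero_extend k (i - 1) y) i =
      shift tT i (zero_extend k (i - 1) y)"
    if i: "i \<in> {1..k}" and y: "y \<in> prod_points p a (i - 1)" for i y
  proof -
    have z: "zero_extend k (i - 1) y \<in> prod_points p a k" by (rule zero_extend_points[OF y])
    show ?thesis
    proof (rule Zp_points_eqI[OF PiE_mem[OF translation_of_points[OF z] i] shift_mem[OF tT z i]])
      fix j assume j: "enat j < a i"
      have "zero_extend k (i - 1) y i j = 0" using i j by (auto simp: zero_extend_def)
      then show "int p dvd translation_of p a k tT (zero_extend k (i - 1) y) i j -
          shift tT i (zero_extend k (i - 1) y) j"
        unfolding translation_of_coord[OF z i j] by (simp add: mod_eq_dvd_iff[symmetric])
    qed
  qed
  have "fst (params_of k (translation_of p a k tT)) = fst tT"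
    using component[of 1 "\<lambda>_. undefined"] k by (simp add: params_of_def shift_def)
  moreover have "snd (params_of k (translation_of p a k tT)) = snd tT"
  proof (rule extensionalityI[of _ "{2..k}"])
    show "snd (params_of k (translation_of p a k tT)) \<in> extensional {2..k}"
      by (simp add: params_of_def)
    show "snd tT \<in> extensional {2..k}"
      using tT by (auto simp: translation_params_def PiE_iff)
    fix i assume i: "i \<in> {2..k}"
    then have "snd tT i \<in> cont_hom (prod_D_Zp p a (i - 1)) (D_Zp (i - 1) p (a i))"
      by (rule translation_params_component[OF tT])
    then have "snd tT i \<in> prod_points p a (i - 1) \<rightarrow>\<^sub>E Zp_points p (a i)"
      unfolding cont_hom_def cubespace_morphism_def topspace_prod top_of_D_Zp
        topspace_Zp_power_top by blast
    then have "snd tT i \<in> extensional (prod_points p a (i - 1))" by (simp only: PiE_def Int_iff)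
    moreover have "translation_of p a k tT (zero_extend k (i - 1) y) i = snd tT i y"
      if "y \<in> prod_points p a (i - 1)" for y
      using component[OF _ that] shift_zero_extend[OF i that, of tT] i by simp
    ultimately have "(\<lambda>y\<in>prod_points p a (i - 1). translation_of p a k tT (zero_extend k (i - 1) y) i) = snd tT i"
      by (intro extensionalityI[of _ "prod_points p a (i - 1)"]) simp_all
    then show "snd (params_of k (translation_of p a k tT)) i = snd tT i"
      using i by (simp add: params_of_def)
  qed
  ultimately show ?thesis by (rule prod_eqI)
qed

text \<open>To compute \<open>\<alpha>\<close> in component \<open>i\<close> at \<open>x\<close>, compare \<open>x\<close> with the point \<open>z\<close> that agrees with it below \<open>i\<close> and is zero
  from \<open>i\<close> on: both have the same \<open>i\<close>-th displacement, and \<open>z\<close> is where the parameters are read off.\<close>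

lemma translation_of_params_of:
  assumes k: "1 \<le> k" and \<alpha>: "\<alpha> \<in> Theta (prod_D_Zp p a k)"
  shows "translation_of p a k (params_of k \<alpha>) = \<alpha>"
proof (rule extensionalityI[of _ "prod_points p a k"])
  have maps: "\<alpha> \<in> prod_points p a k \<rightarrow> prod_points p a k"
    using \<alpha> by (simp add: Theta_def translation_def topspace_prod bij_betw_imp_funcset)
  have pres: "preserves_cubes_on_faces (prod_D_Zp p a k) \<alpha>"
    using \<alpha> by (simp add: Theta_def translation_def)
  show "translation_of p a k (params_of k \<alpha>) \<in> extensional (prod_points p a k)"
    by (simp add: translation_of_def topspace_prod split: prod.split)
  show "\<alpha> \<in> extensional (prod_points p a k)"
    using \<alpha> by (simp add: Theta_def translation_def topspace_prod)
  fix x assume x: "x \<in> prod_points p a k"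
  show "translation_of p a k (params_of k \<alpha>) x = \<alpha> x"
  proof (rule PiE_ext[OF translation_of_points[OF x] funcset_mem[OF maps x]])
    fix i assume i: "i \<in> {1..k}"
    define z where "z = zero_extend k (i - 1) (restrict x {1..i - 1})"
    have ik: "i - 1 \<le> k" using i by auto
    have z: "z \<in> prod_points p a k"
      unfolding z_def by (rule zero_extend_points[OF restrict_points[OF x ik]])
    have z_low: "z i' = x i'" if "i' \<in> {1..<i}" for i'
      using that i by (auto simp: z_def zero_extend_def)
    have "shift (params_of k \<alpha>) i x = \<alpha> z i"
    proof (cases "i = 1")
      case True
      have "z = zero_extend k 0 (\<lambda>_. undefined)"
        using True by (simp add: z_def restrict_def)
      then show ?thesis using True by (simp add: shift_def params_of_def)
    next
      case False
      then show ?thesis using i restrict_points[OF x ik]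
        by (simp add: shift_def params_of_def z_def)
    qed
    note shift_eq = this
    show "translation_of p a k (params_of k \<alpha>) x i = \<alpha> x i"
    proof (rule Zp_points_eqI[OF PiE_mem[OF translation_of_points[OF x] i] PiE_mem[OF funcset_mem[OF maps x] i]])
      fix j assume j: "enat j < a i"
      have "z i j = 0" using i j by (auto simp: z_def zero_extend_def)
      moreover have "int p dvd (\<alpha> z i j - z i j) - (\<alpha> x i j - x i j)"
        by (rule difference_depends_on_lower_components[OF maps pres x z _ i j]) (simp add: z_low)
      ultimately have "int p dvd (x i j + \<alpha> z i j) - \<alpha> x i j" by (simp add: algebra_simps)
      then show "int p dvd translation_of p a k (params_of k \<alpha>) x i j - \<alpha> x i j"
        by (simp add: translation_of_coord[OF x i j] shift_eq mod_eq_dvd_iff[symmetric])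
    qed
  qed
qed

end

theorem theorem5p9:
  fixes p k :: nat and a :: "nat \<Rightarrow> enat"
  assumes "prime p" and "1 \<le> k" and "k \<le> p"
  shows "bij_betw (translation_of p a k) (translation_params p a k) (Theta (prod_D_Zp p a k))"
proof -
  have p: "0 < p" using assms(1) by (rule prime_gt_0_nat)
  show ?thesis
    by (rule bij_betw_byWitness[where f' = "params_of p a k"])
      (auto simp: params_of_translation_of[OF p assms(2)] translation_of_params_of[OF p assms(2)]
        translation_of_mem[OF p] params_of_mem[OF p assms(2)])
qed

end
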